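(* Let $d\ge1$ and $L^\infty=L^\infty(\mathbb{R}^d)$. The space $\mathcal{S}'_h\cap L^\infty$ is not complemented in $L^\infty$: there exists no subspace $G\subset L^\infty$ such that $L^\infty=(\mathcal{S}'_h\cap L^\infty)\oplus G$ with continuous projections.
   Context: Functions are complex-valued. Fix a smooth radial function $\chi:\mathbb{R}^d\to\mathbb{R}$ supported in the ball $B(0,2)$, equal to $1$ in a neighborhood of $B(0,1)$, and such that $r\mapsto\chi(re)$ is nonincreasing on $\mathbb{R}_+$ for every unit vector $e$. $\mathcal{S}'_h$ is the space of tempered distributions $f\in\mathcal{S}'(\mathbb{R}^d)$ such that $\chi(\lambda\xi)\widehat f(\xi)\to0$ in $\mathcal{S}'$ as $\lambda\to+\infty$. *)

theory Defs
  imports "HOL-Analysis.Analysis" "HOL-Probability.Essential_Supremum"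
begin

text \<open>$L^\infty$ consists of classes of essentially bounded Borel functions modulo equality almost everywhere; as every Lebesgue measurable
  function agrees almost everywhere with a Borel function, these are the same classes as for the
  completed measure.\<close>

definition ess_bounded :: "('a::euclidean_space \<Rightarrow> complex) \<Rightarrow> bool" where
  "ess_bounded f \<longleftrightarrow> f \<in> borel_measurable lborel \<and> esssup lborel (\<lambda>x. ereal (cmod (f x))) < \<infinity>"

lemma ess_boundedI:
  assumes "f \<in> borel_measurable lborel" "AE x in lborel. cmod (f x) \<le> c"
  shows "ess_bounded f"
proof -
  have "esssup lborel (\<lambda>x. ereal (cmod (f x))) \<le> ereal c"
    using assms by (intro esssup_I) auto
  also have "\<dots> < \<infinity>" by simp
  finally show ?thesis using assms by (simp add: ess_bounded_def)
qed

lemma esssup_cmod_nonneg: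
  fixes f :: "'a::euclidean_space \<Rightarrow> complex"
  assumes "f \<in> borel_measurable lborel"
  shows "0 \<le> esssup lborel (\<lambda>x. ereal (cmod (f x)))"
proof -
  have "esssup lborel (\<lambda>x::'a. (0::ereal)) \<le> esssup lborel (\<lambda>x. ereal (cmod (f x)))"
    using assms by (intro esssup_mono) auto
  moreover have "esssup lborel (\<lambda>x::'a. (0::ereal)) = 0"
    by (intro esssup_const) simp
  ultimately show ?thesis by simp
qed

lemma ess_bounded_AE:
  assumes "ess_bounded f"
  shows "AE x in lborel. cmod (f x) \<le> real_of_ereal (esssup lborel (\<lambda>x. ereal (cmod (f x))))"
proof -
  let ?s = "esssup lborel (\<lambda>x. ereal (cmod (f x)))"
  have "0 \<le> ?s" "?s < \<infinity>"
    using assms esssup_cmod_nonneg by (auto simp: ess_bounded_def)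
  then have "ereal (real_of_ereal ?s) = ?s"
    by (intro ereal_real') auto
  then show ?thesis
    using esssup_AE[of "\<lambda>x. ereal (cmod (f x))" lborel] by (metis (mono_tags, lifting) ereal_less_eq(3) eventually_mono)
qed

lemma ess_bounded_iff:
  "ess_bounded f \<longleftrightarrow> f \<in> borel_measurable lborel \<and> (\<exists>c. AE x in lborel. cmod (f x) \<le> c)"
  using ess_boundedI ess_bounded_AE by (auto simp: ess_bounded_def)

lemma ess_bounded_const: "ess_bounded (\<lambda>x. c)"
  by (rule ess_boundedI[where c = "cmod c"]) auto

lemma ess_bounded_add:
  assumes "ess_bounded f" "ess_bounded g"
  shows "ess_bounded (\<lambda>x. f x + g x)"
proof -
  obtain a b where "AE x in lborel. cmod (f x) \<le> a" "AE x in lborel. cmod (g x) \<le> b"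
    using assms by (auto simp: ess_bounded_iff)
  then have "AE x in lborel. cmod (f x + g x) \<le> a + b"
    by eventually_elim (rule norm_triangle_mono)
  then show ?thesis
    using assms by (intro ess_boundedI) (auto simp: ess_bounded_iff)
qed

lemma ess_bounded_cmult:
  assumes "ess_bounded f"
  shows "ess_bounded (\<lambda>x. c * f x)"
proof -
  obtain a where "AE x in lborel. cmod (f x) \<le> a"
    using assms by (auto simp: ess_bounded_iff)
  then have "AE x in lborel. cmod (c * f x) \<le> cmod c * a"
    by eventually_elim (simp add: norm_mult mult_left_mono)
  then show ?thesis
    using assms by (intro ess_boundedI) (auto simp: ess_bounded_iff)
qed

definition linf_rel :: "('a::euclidean_space \<Rightarrow> complex) \<Rightarrow> ('a \<Rightarrow> complex) \<Rightarrow> bool" where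
  "linf_rel f g \<longleftrightarrow> ess_bounded f \<and> ess_bounded g \<and> (AE x in lborel. f x = g x)"

lemma part_equivp_linf_rel: "part_equivp (linf_rel :: ('a::euclidean_space \<Rightarrow> complex) \<Rightarrow> _)"
proof (rule part_equivpI)
  show "\<exists>f::'a \<Rightarrow> complex. linf_rel f f"
    by (auto simp: linf_rel_def intro: ess_bounded_const)
  show "symp (linf_rel :: ('a \<Rightarrow> complex) \<Rightarrow> _)"
    by (auto simp: linf_rel_def symp_def elim: eventually_mono)
  show "transp (linf_rel :: ('a \<Rightarrow> complex) \<Rightarrow> _)"
  proof (rule transpI)
    fix f g h :: "'a \<Rightarrow> complex"
    assume a: "linf_rel f g" "linf_rel g h"
    then have "AE x in lborel. f x = g x" "AE x in lborel. g x = h x"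
      by (auto simp: linf_rel_def)
    then have "AE x in lborel. f x = h x"
      by eventually_elim simp
    with a show "linf_rel f h"
      by (simp add: linf_rel_def)
  qed
qed

quotient_type (overloaded) 'a linf = "'a::euclidean_space \<Rightarrow> complex" / partial: linf_rel
  by (rule part_equivp_linf_rel)

lift_definition scaleC_linf :: "complex \<Rightarrow> 'a::euclidean_space linf \<Rightarrow> 'a linf"
  is "\<lambda>c f x. c * f x"
  subgoal for c f g
    by (auto simp: linf_rel_def ess_bounded_cmult elim: eventually_mono)
  done

instantiation linf :: (euclidean_space) real_normed_vector
begin

lift_definition zero_linf :: "'a linf" is "\<lambda>x. 0"
  by (auto simp: linf_rel_def intro: ess_bounded_const)

lift_definition plus_linf :: "'a linf \<Rightarrow> 'a linf \<Rightarrow> 'a linf" is "\<lambda>f g x. f x + g x"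
  by (auto simp: linf_rel_def ess_bounded_add elim: eventually_elim2)

definition uminus_linf :: "'a linf \<Rightarrow> 'a linf" where
  "uminus_linf f = scaleC_linf (-1) f"

definition minus_linf :: "'a linf \<Rightarrow> 'a linf \<Rightarrow> 'a linf" where
  "minus_linf f g = f + - g"

definition scaleR_linf :: "real \<Rightarrow> 'a linf \<Rightarrow> 'a linf" where
  "scaleR_linf r f = scaleC_linf (complex_of_real r) f"

lift_definition norm_linf :: "'a linf \<Rightarrow> real"
  is "\<lambda>f. real_of_ereal (esssup lborel (\<lambda>x. ereal (cmod (f x))))"
proof -
  fix f g :: "'a \<Rightarrow> complex"
  assume "linf_rel f g"
  then have "AE x in lborel. ereal (cmod (f x)) = ereal (cmod (g x))"
    by (auto simp: linf_rel_def elim: eventually_mono)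
  then have "esssup lborel (\<lambda>x. ereal (cmod (f x))) = esssup lborel (\<lambda>x. ereal (cmod (g x)))"
    using \<open>linf_rel f g\<close> by (intro esssup_AE_cong) (auto simp: linf_rel_def ess_bounded_def)
  then show "real_of_ereal (esssup lborel (\<lambda>x. ereal (cmod (f x)))) =
      real_of_ereal (esssup lborel (\<lambda>x. ereal (cmod (g x))))" by simp
qed

definition dist_linf :: "'a linf \<Rightarrow> 'a linf \<Rightarrow> real" where
  "dist_linf f g = norm (f - g)"

definition sgn_linf :: "'a linf \<Rightarrow> 'a linf" where
  "sgn_linf f = scaleR (inverse (norm f)) f"

definition uniformity_linf :: "('a linf \<times> 'a linf) filter" where
  "uniformity_linf = (INF e\<in>{0 <..}. principal {(x, y). dist x y < e})"

definition open_linf :: "'a linf set \<Rightarrow> bool" where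
  "open_linf U \<longleftrightarrow> (\<forall>x\<in>U. eventually (\<lambda>(x', y). x' = x \<longrightarrow> y \<in> U) uniformity)"

context
begin

private lemma lin:
  fixes f g h :: "'a linf"
  shows "f + g + h = f + (g + h)" "f + g = g + f" "0 + f = f"
    "scaleC_linf c (f + g) = scaleC_linf c f + scaleC_linf c g"
    "scaleC_linf (c + d) f = scaleC_linf c f + scaleC_linf d f"
    "scaleC_linf c (scaleC_linf d f) = scaleC_linf (c * d) f"
    "scaleC_linf 1 f = f" "scaleC_linf 0 f = 0"
  by (transfer; auto simp: linf_rel_def algebra_simps
        intro!: ess_bounded_add ess_bounded_cmult ess_bounded_const)+

private lemma norm_leI:
  assumes "ess_bounded f" "AE x in lborel. cmod (f x) \<le> c"
  shows "real_of_ereal (esssup lborel (\<lambda>x. ereal (cmod (f x)))) \<le> c"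
proof -
  have f: "f \<in> borel_measurable lborel" using assms(1) by (simp add: ess_bounded_def)
  have "esssup lborel (\<lambda>x. ereal (cmod (f x))) \<le> ereal c"
    using assms f by (intro esssup_I) auto
  then have "real_of_ereal (esssup lborel (\<lambda>x. ereal (cmod (f x)))) \<le> real_of_ereal (ereal c)"
    by (intro real_of_ereal_positive_mono esssup_cmod_nonneg f) auto
  then show ?thesis by simp
qed

private lemma nrm_add: "norm (f + g) \<le> norm f + norm (g :: 'a linf)"
proof transfer
  fix f g :: "'a \<Rightarrow> complex"
  assume "linf_rel f f" "linf_rel g g"
  then have fg: "ess_bounded f" "ess_bounded g" by (auto simp: linf_rel_def)
  show "real_of_ereal (esssup lborel (\<lambda>x. ereal (cmod (f x + g x)))) \<le>
      real_of_ereal (esssup lborel (\<lambda>x. ereal (cmod (f x)))) +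
      real_of_ereal (esssup lborel (\<lambda>x. ereal (cmod (g x))))"
    apply (intro norm_leI ess_bounded_add fg)
    using ess_bounded_AE[OF fg(1)] ess_bounded_AE[OF fg(2)]
    by eventually_elim (rule norm_triangle_mono)
qed

private lemma nrm_scaleC_le: "norm (scaleC_linf c f) \<le> cmod c * norm (f :: 'a linf)"
proof transfer
  fix c and f :: "'a \<Rightarrow> complex"
  assume "linf_rel f f"
  then have f: "ess_bounded f" by (auto simp: linf_rel_def)
  show "real_of_ereal (esssup lborel (\<lambda>x. ereal (cmod (c * f x)))) \<le>
      cmod c * real_of_ereal (esssup lborel (\<lambda>x. ereal (cmod (f x))))"
    apply (intro norm_leI ess_bounded_cmult f)
    using ess_bounded_AE[OF f]
    by eventually_elim (simp add: norm_mult mult_left_mono)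
qed

private lemma nrm_nonneg: "0 \<le> norm (f :: 'a linf)"
  by transfer (intro real_of_ereal_pos esssup_cmod_nonneg, simp add: linf_rel_def ess_bounded_def)

private lemma nrm_zero_iff: "norm f = 0 \<longleftrightarrow> (f :: 'a linf) = 0"
proof transfer
  fix f :: "'a \<Rightarrow> complex"
  assume "linf_rel f f"
  then have f: "ess_bounded f" by (auto simp: linf_rel_def)
  show "(real_of_ereal (esssup lborel (\<lambda>x. ereal (cmod (f x)))) = 0) = linf_rel f (\<lambda>x. 0)"
  proof
    assume "real_of_ereal (esssup lborel (\<lambda>x. ereal (cmod (f x)))) = 0"
    with ess_bounded_AE[OF f] have "AE x in lborel. f x = 0" by auto
    with f show "linf_rel f (\<lambda>x. 0)" by (simp add: linf_rel_def ess_bounded_const)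
  next
    assume "linf_rel f (\<lambda>x. 0)"
    then have "AE x in lborel. cmod (f x) \<le> 0" by (auto simp: linf_rel_def)
    from norm_leI[OF f this]
    show "real_of_ereal (esssup lborel (\<lambda>x. ereal (cmod (f x)))) = 0"
      using f by (intro antisym real_of_ereal_pos esssup_cmod_nonneg) (auto simp: ess_bounded_def)
  qed
qed

private lemma nrm_scaleC: "norm (scaleC_linf c f) = cmod c * norm (f :: 'a linf)"
proof (cases "c = 0")
  case True
  then show ?thesis by (simp add: lin nrm_zero_iff)
next
  case False
  have "norm f = norm (scaleC_linf (inverse c) (scaleC_linf c f))"
    using False by (simp add: lin)
  also have "\<dots> \<le> cmod (inverse c) * norm (scaleC_linf c f)"
    by (rule nrm_scaleC_le)
  finally have "cmod c * norm f \<le> norm (scaleC_linf c f)"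
    using False by (simp add: norm_inverse norm_divide field_simps)
  with nrm_scaleC_le[of c f] show ?thesis by simp
qed

instance
proof
  fix f g h :: "'a linf" and r s :: real and U :: "'a linf set"
  show "- f + f = 0"
    using lin(5)[of "-1" 1 f] by (simp add: uminus_linf_def lin)
  show "r *\<^sub>R (f + g) = r *\<^sub>R f + r *\<^sub>R g" "(r + s) *\<^sub>R f = r *\<^sub>R f + s *\<^sub>R f"
    "r *\<^sub>R s *\<^sub>R f = (r * s) *\<^sub>R f" "1 *\<^sub>R f = f"
    by (simp_all add: scaleR_linf_def lin)
  show "norm (r *\<^sub>R f) = \<bar>r\<bar> * norm f"
    by (simp add: scaleR_linf_def nrm_scaleC)
qed (rule lin minus_linf_def dist_linf_def sgn_linf_def uniformity_linf_def open_linf_def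
       nrm_add nrm_zero_iff)+

end

end

interpretation linf: vector_space "scaleC_linf :: complex \<Rightarrow> 'a::euclidean_space linf \<Rightarrow> 'a linf"
proof
  fix c d :: complex and f g :: "'a linf"
  show "scaleC_linf c (f + g) = scaleC_linf c f + scaleC_linf c g"
    "scaleC_linf (c + d) f = scaleC_linf c f + scaleC_linf d f"
    "scaleC_linf c (scaleC_linf d f) = scaleC_linf (c * d) f"
    "scaleC_linf 1 f = f"
    by (transfer; auto simp: linf_rel_def algebra_simps
        intro!: ess_bounded_add ess_bounded_cmult)+
qed

text \<open>The linear projections along a decomposition are determined by it, so asking for some
  functions picking out continuous components is the same as continuity of the projections.\<close>

definition topological_direct_sum :: "'b::real_normed_vector set \<Rightarrow> 'b set \<Rightarrow> bool" where
  "topological_direct_sum X G \<longleftrightarrow> X \<inter> G = {0} \<and>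
     (\<exists>P Q. (\<forall>f. P f \<in> X \<and> Q f \<in> G \<and> f = P f + Q f) \<and>
            continuous_on UNIV P \<and> continuous_on UNIV Q)"

text \<open>A multi-index $\beta$ is represented by a list of basis vectors of length $|\beta|$.\<close>

definition iter_partial ::
    "'a::euclidean_space list \<Rightarrow> ('a \<Rightarrow> 'b::real_normed_vector) \<Rightarrow> 'a \<Rightarrow> 'b" where
  "iter_partial bs f = foldr (\<lambda>b g x. frechet_derivative g (at x) b) bs f"

definition smooth :: "('a::euclidean_space \<Rightarrow> 'b::real_normed_vector) \<Rightarrow> bool" where
  "smooth f \<longleftrightarrow> (\<forall>bs\<in>lists Basis. \<forall>x. iter_partial bs f differentiable (at x))"

definition schwartz_seminorm :: "nat \<Rightarrow> 'a::euclidean_space list \<Rightarrow> ('a \<Rightarrow> complex) \<Rightarrow> real" where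
  "schwartz_seminorm k bs \<phi> = (SUP x. (1 + norm x) ^ k * cmod (iter_partial bs \<phi> x))"

definition schwartz :: "('a::euclidean_space \<Rightarrow> complex) set" where
  "schwartz = {\<phi>. smooth \<phi> \<and>
     (\<forall>k. \<forall>bs\<in>lists Basis. bdd_above (range (\<lambda>x. (1 + norm x) ^ k * cmod (iter_partial bs \<phi> x))))}"

definition schwartz_topology :: "('a::euclidean_space \<Rightarrow> complex) topology" where
  "schwartz_topology = topology_generated_by
     {{\<psi>\<in>schwartz. schwartz_seminorm k bs (\<lambda>x. \<psi> x - \<phi> x) < \<epsilon>} | \<phi> k bs \<epsilon>.
        \<phi> \<in> schwartz \<and> bs \<in> lists Basis \<and> 0 < \<epsilon>}"

text \<open>Distributions are total functions on the type of all functions; only their values on the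
  Schwartz space are meaningful.\<close>

type_synonym 'a functional = "('a \<Rightarrow> complex) \<Rightarrow> complex"

definition tempered :: "'a::euclidean_space functional set" where
  "tempered = {T.
     (\<forall>\<phi>\<in>schwartz. \<forall>\<psi>\<in>schwartz. T (\<lambda>x. \<phi> x + \<psi> x) = T \<phi> + T \<psi>) \<and>
     (\<forall>c. \<forall>\<phi>\<in>schwartz. T (\<lambda>x. c * \<phi> x) = c * T \<phi>) \<and>
     continuous_map schwartz_topology euclidean T}"

text \<open>$\mathcal{S}'$ carries the weak-* topology.\<close>

definition tempered_tendsto ::
    "('i \<Rightarrow> 'a::euclidean_space functional) \<Rightarrow> 'a functional \<Rightarrow> 'i filter \<Rightarrow> bool" where
  "tempered_tendsto T L F \<longleftrightarrow> (\<forall>\<phi>\<in>schwartz. ((\<lambda>i. T i \<phi>) \<longlongrightarrow> L \<phi>) F)"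

definition fourier :: "('a::euclidean_space \<Rightarrow> complex) \<Rightarrow> 'a \<Rightarrow> complex" where
  "fourier \<phi> \<xi> = (LINT x|lborel. cis (- (x \<bullet> \<xi>)) * \<phi> x)"

definition fourier_distr :: "'a::euclidean_space functional \<Rightarrow> 'a functional" where
  "fourier_distr T \<phi> = T (fourier \<phi>)"

definition mult_distr :: "('a::euclidean_space \<Rightarrow> real) \<Rightarrow> 'a functional \<Rightarrow> 'a functional" where
  "mult_distr m T \<phi> = T (\<lambda>x. complex_of_real (m x) * \<phi> x)"

text \<open>$B(0,r)$ is read as the closed ball.\<close>

definition low_freq_cutoff :: "('a::euclidean_space \<Rightarrow> real) \<Rightarrow> bool" where
  "low_freq_cutoff chi \<longleftrightarrow> smooth chi \<and>
     (\<forall>x y. norm x = norm y \<longrightarrow> chi x = chi y) \<and>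
     closure {x. chi x \<noteq> 0} \<subseteq> cball 0 2 \<and>
     (\<exists>U. open U \<and> cball 0 1 \<subseteq> U \<and> (\<forall>x\<in>U. chi x = 1)) \<and>
     (\<forall>e. norm e = 1 \<longrightarrow> antimono_on {0..} (\<lambda>r. chi (r *\<^sub>R e)))"

definition Sh' :: "('a::euclidean_space \<Rightarrow> real) \<Rightarrow> 'a functional set" where
  "Sh' chi = {T\<in>tempered.
     tempered_tendsto (\<lambda>l. mult_distr (\<lambda>\<xi>. chi (l *\<^sub>R \<xi>)) (fourier_distr T)) (\<lambda>\<phi>. 0) at_top}"

text \<open>The case distinction only serves to make the value independent of the representative;
  Schwartz functions are Borel measurable.\<close>

lift_definition linf_distr :: "'a::euclidean_space linf \<Rightarrow> 'a functional"
  is "\<lambda>f \<phi>. if \<phi> \<in> borel_measurable borel then LINT x|lborel. f x * \<phi> x else 0"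
proof (rule ext)
  fix f g \<phi> :: "'a \<Rightarrow> complex"
  assume "linf_rel f g"
  then have fg: "f \<in> borel_measurable lborel" "g \<in> borel_measurable lborel" "AE x in lborel. f x = g x"
    by (auto simp: linf_rel_def ess_bounded_def)
  have "(LINT x|lborel. f x * \<phi> x) = (LINT x|lborel. g x * \<phi> x)" if "\<phi> \<in> borel_measurable borel"
    using fg that by (intro integral_cong_AE) (auto elim: eventually_mono)
  then show "(if \<phi> \<in> borel_measurable borel then LINT x|lborel. f x * \<phi> x else 0) =
      (if \<phi> \<in> borel_measurable borel then LINT x|lborel. g x * \<phi> x else 0)"
    by simp
qed

definition Sh_linf :: "('a::euclidean_space \<Rightarrow> real) \<Rightarrow> 'a linf set" where
  "Sh_linf chi = {f. linf_distr f \<in> Sh' chi}"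

end

theory Submission
  imports Defs
begin

text \<open>Whitley's argument for the uncomplementedness of $c_0$ in $\ell^\infty$ is transported to
  $L^\infty$. Split space into concentric shells around spheres of radii $R_n$ with
  $R_{n+1}/R_n \to \infty$, and put on the $n$-th shell the conjugate phase of
  $\widehat\chi(\cdot/R_n)$. For a set $A$ of indices let $F_A$ be the restriction of this function to
  the shells in $A$. Testing the cutoff against $\chi$ itself at scale $R_n$, $n \in A$, yields a
  quantity close to $\|\widehat\chi\|_{L^1} > 0$, so $F_A \notin \mathcal{S}'_h$ when $A$ is infinite; on
  the other hand every bounded function of bounded support lies in $\mathcal{S}'_h$.

  Suppose $Q$ is a continuous linear map on $L^\infty$ with kernel $\mathcal{S}'_h \cap L^\infty$, and let
  $(A_s)$ be an uncountable almost disjoint family. Sums of $F_{A_s}$ with unimodular coefficients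
  have norm at most one modulo functions of bounded support, so each continuous functional of $Q F_{A_s}$
  vanishes for all but countably many $s$. Countably many functionals, namely weighted integrals
  over a countable generator of the Borel sets, separate the points of $L^\infty$, whence
  $Q F_{A_s} = 0$ for some $s$, a contradiction.\<close>

subsection \<open>Essentially bounded functions as functionals\<close>

lemma linf_cases:
  obtains f' where "f = abs_linf f'" "ess_bounded f'" "linf_rel f' f'"
proof -
  have "linf_rel (rep_linf f) (rep_linf f)"
    by (rule Quotient_rep_reflp[OF Quotient_linf])
  then show ?thesis
    using that[of "rep_linf f"] Quotient_abs_rep[OF Quotient_linf, of f]
    by (auto simp: linf_rel_def)
qed

lemma linf_rel_refl: "ess_bounded f \<Longrightarrow> linf_rel f f"
  by (simp add: linf_rel_def)

lemma linf_distr_abs: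
  assumes "ess_bounded f" "\<phi> \<in> borel_measurable borel"
  shows "linf_distr (abs_linf f) \<phi> = (LINT x|lborel. f x * \<phi> x)"
  using assms by (simp add: linf_distr.abs_eq linf_rel_refl)

lemma ess_bounded_norm_AE:
  assumes "ess_bounded f"
  shows "AE x in lborel. cmod (f x) \<le> norm (abs_linf f)"
  using ess_bounded_AE[OF assms] assms by (simp add: norm_linf.abs_eq linf_rel_refl)

lemma norm_abs_linf_le:
  assumes "ess_bounded f" "AE x in lborel. cmod (f x) \<le> c"
  shows "norm (abs_linf f) \<le> c"
proof -
  have f: "f \<in> borel_measurable lborel" using assms(1) by (simp add: ess_bounded_def)
  have "esssup lborel (\<lambda>x. ereal (cmod (f x))) \<le> ereal c"
    using assms f by (intro esssup_I) auto
  then have "real_of_ereal (esssup lborel (\<lambda>x. ereal (cmod (f x)))) \<le> real_of_ereal (ereal c)"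
    by (intro real_of_ereal_positive_mono esssup_cmod_nonneg f) auto
  then show ?thesis
    using assms(1) by (simp add: norm_linf.abs_eq linf_rel_refl)
qed

lemma ess_bounded_mult_integrable:
  assumes "ess_bounded f" "integrable lborel \<phi>"
  shows "integrable lborel (\<lambda>x. f x * \<phi> x)"
proof (rule Bochner_Integration.integrable_bound)
  show "integrable lborel (\<lambda>x. norm (abs_linf f) * cmod (\<phi> x))"
    using assms(2) by simp
  show "(\<lambda>x. f x * \<phi> x) \<in> borel_measurable lborel"
    using assms by (auto simp: ess_bounded_def)
  show "AE x in lborel. norm (f x * \<phi> x) \<le> norm (norm (abs_linf f) * cmod (\<phi> x))"
    using ess_bounded_norm_AE[OF assms(1)]
    by eventually_elim (simp add: norm_mult mult_right_mono)
qed

text \<open>Hoelder's inequality with exponents infinity and one; it makes evaluation at an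
  integrable \<open>\<phi>\<close> a continuous functional.\<close>

lemma linf_distr_bound:
  assumes "integrable lborel \<phi>"
  shows "cmod (linf_distr f \<phi>) \<le> norm f * (LINT x|lborel. cmod (\<phi> x))"
proof (cases f rule: linf_cases)
  case (1 f')
  have "cmod (linf_distr f \<phi>) = cmod (LINT x|lborel. f' x * \<phi> x)"
    using assms 1 by (simp add: linf_distr_abs)
  also have "\<dots> \<le> (LINT x|lborel. cmod (f' x * \<phi> x))"
    by (rule integral_norm_bound)
  also have "\<dots> \<le> (LINT x|lborel. norm f * cmod (\<phi> x))"
    using assms ess_bounded_norm_AE[OF 1(2)] 1(1)
    by (intro integral_mono_AE integrable_norm ess_bounded_mult_integrable 1(2) integrable_mult_right)
      (auto simp: norm_mult elim!: eventually_mono intro: mult_right_mono)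
  finally show ?thesis by simp
qed

lemma linf_distr_add:
  assumes "integrable lborel \<phi>"
  shows "linf_distr (f + g) \<phi> = linf_distr f \<phi> + linf_distr g \<phi>"
proof (cases f rule: linf_cases)
  case f: (1 f')
  show ?thesis
  proof (cases g rule: linf_cases)
    case g: (1 g')
    have "linf_distr (f + g) \<phi> = (LINT x|lborel. (f' x + g' x) * \<phi> x)"
      using f g assms by (simp add: plus_linf.abs_eq linf_distr_abs ess_bounded_add)
    then show ?thesis
      using f g assms
      by (simp add: linf_distr_abs distrib_right Bochner_Integration.integral_add
          ess_bounded_mult_integrable)
  qed
qed

lemma linf_distr_scaleC: "linf_distr (scaleC_linf c f) \<phi> = c * linf_distr f \<phi>"
proof (cases f rule: linf_cases)
  case (1 f')
  then show ?thesis
    by (simp add: scaleC_linf.abs_eq linf_distr.abs_eq linf_rel_refl ess_bounded_cmult mult.assoc)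
qed

lemma linf_distr_scaleR: "linf_distr (r *\<^sub>R f) \<phi> = of_real r * linf_distr f \<phi>"
  by (simp add: scaleR_linf_def linf_distr_scaleC)

lemma linf_distr_arg_add:
  assumes "integrable lborel \<phi>" "integrable lborel \<psi>"
  shows "linf_distr f (\<lambda>x. \<phi> x + \<psi> x) = linf_distr f \<phi> + linf_distr f \<psi>"
  by (cases f rule: linf_cases)
    (use assms in \<open>auto simp: linf_distr_abs distrib_left ess_bounded_mult_integrable
      Bochner_Integration.integral_add\<close>)

lemma linf_distr_arg_cmult:
  assumes "\<phi> \<in> borel_measurable borel"
  shows "linf_distr f (\<lambda>x. c * \<phi> x) = c * linf_distr f \<phi>"
  by (cases f rule: linf_cases)
    (use assms in \<open>auto simp: linf_distr_abs mult.left_commute\<close>)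

text \<open>Serves to expand signed finite sums of shell functions under a real-linear functional,
  hence the real coefficients.\<close>

lemma abs_linf_sum:
  assumes "finite S" "\<And>i. i \<in> S \<Longrightarrow> ess_bounded (f i)"
  shows "ess_bounded (\<lambda>x. \<Sum>i\<in>S. of_real (s i) * f i x) \<and>
    abs_linf (\<lambda>x. \<Sum>i\<in>S. of_real (s i) * f i x) = (\<Sum>i\<in>S. s i *\<^sub>R abs_linf (f i))"
  using assms
proof (induction S rule: finite_induct)
  case empty
  then show ?case by (simp add: ess_bounded_const zero_linf.abs_eq)
next
  case (insert j S)
  then have IH: "ess_bounded (\<lambda>x. \<Sum>i\<in>S. of_real (s i) * f i x)"
    "abs_linf (\<lambda>x. \<Sum>i\<in>S. of_real (s i) * f i x) = (\<Sum>i\<in>S. s i *\<^sub>R abs_linf (f i))"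
    and j: "ess_bounded (f j)" by auto
  then show ?case
    using insert.hyps
    by (simp add: ess_bounded_add ess_bounded_cmult scaleR_linf_def scaleC_linf.abs_eq linf_rel_refl
        flip: plus_linf.abs_eq IH(2))
qed

text \<open>The weight makes the product of \<open>f\<close> and \<open>w\<close> integrable over
  the whole space, so its integrals over Borel sets are determined by those over the
  intersection-stable generator \<open>E\<close>. If they all vanish, the product is zero almost
  everywhere, and the positive \<open>w\<close> can be divided out.\<close>

lemma linf_eq_0I:
  fixes f :: "'a::euclidean_space linf"
  assumes w: "integrable lborel w" "\<And>x. w x > 0"
    and E: "Int_stable E" "UNIV \<in> E" "sets borel = sigma_sets UNIV E"
    and zero: "\<And>U. U \<in> E \<Longrightarrow> linf_distr f (\<lambda>x. of_real (indicator U x * w x)) = 0"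
  shows "f = 0"
proof (cases f rule: linf_cases)
  case (1 f')
  let ?g = "\<lambda>x. f' x * of_real (w x)"
  have int: "integrable lborel ?g"
    using w 1(2) by (intro ess_bounded_mult_integrable) auto
  have wm: "w \<in> borel_measurable borel"
    using w by auto
  have "set_lebesgue_integral lborel A ?g = 0" if "A \<in> sets lborel" for A
  proof -
    have si: "set_integrable lborel B ?g" if "B \<in> sets borel" for B
      unfolding set_integrable_def using that by (intro integrable_mult_indicator int) auto
    have E': "E \<subseteq> Pow UNIV" by auto
    have E_eq: "set_lebesgue_integral lborel U ?g = 0" if "U \<in> E" for U
    proof -
      have [measurable]: "U \<in> sets borel" "w \<in> borel_measurable borel"
        using that wm by (auto simp: E(3))
      have "(\<lambda>x. complex_of_real (indicator U x * w x)) \<in> borel_measurable borel"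
        by measurable
      then show ?thesis
        using zero[OF that] 1
        by (simp add: linf_distr_abs set_lebesgue_integral_def scaleR_conv_of_real ac_simps)
    qed
    \<comment> \<open>Dynkin's argument: the sets over which the integral vanishes are closed under
      complements and countable disjoint unions. The complement case uses that \<open>UNIV\<close>
      belongs to \<open>E\<close>.\<close>
    from that have "A \<in> sigma_sets UNIV E" by (simp add: E(3)[symmetric])
    then show ?thesis
    proof (induction rule: sigma_sets_induct_disjoint[OF E(1) E', consumes 1, case_names basic empty compl union])
      case (basic A)
      then show ?case by (rule E_eq)
    next
      case empty
      then show ?case by (simp add: set_lebesgue_integral_def)
    next
      case (compl A)
      then have A: "A \<in> sets borel" by (simp add: E(3))
      have "set_lebesgue_integral lborel (A \<union> (UNIV - A)) ?g =
          set_lebesgue_integral lborel A ?g + set_lebesgue_integral lborel (UNIV - A) ?g"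
        by (intro set_integral_Un si) (use A in auto)
      then show ?case using compl E_eq[OF E(2)] by simp
    next
      case (union A)
      have A: "\<And>i. A i \<in> sets borel" using union(2) E(3) by auto
      have "set_lebesgue_integral lborel (\<Union>i. A i) ?g = (\<Sum>i. set_lebesgue_integral lborel (A i) ?g)"
        using A union(1)
        by (intro lebesgue_integral_countable_add si) (auto simp: disjoint_family_on_def)
      then show ?case using union by simp
    qed
  qed
  then have "AE x in lborel. ?g x = 0"
    by (intro sigma_finite_measure.density_zero[OF sigma_finite_lborel] int)
  then have "AE x in lborel. f' x = 0"
    by eventually_elim (use w(2) in \<open>auto simp: less_imp_neq[symmetric]\<close>)
  then have "norm f \<le> 0"
    unfolding 1(1) by (intro norm_abs_linf_le 1(2)) simp
  then show ?thesis by simp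
qed

text \<open>Take all finite intersections of members of a countable topological basis; the empty
  intersection supplies \<open>UNIV\<close>.\<close>

lemma countable_borel_generator:
  obtains E :: "'a::euclidean_space set set"
  where "countable E" "Int_stable E" "UNIV \<in> E" "sets borel = sigma_sets UNIV E"
proof -
  obtain B :: "'a set set" where B: "countable B" "topological_basis B"
    using ex_countable_basis by blast
  define E where "E = {\<Inter>F |F. finite F \<and> F \<subseteq> B}"
  have "E = Inter ` {F. finite F \<and> F \<subseteq> B}" by (auto simp: E_def)
  then have 1: "countable E" using B(1) by (simp add: countable_Collect_finite_subset)
  have 2: "Int_stable E"
  proof (rule Int_stableI)
    fix a b assume "a \<in> E" "b \<in> E"
    then obtain F G where "a = \<Inter>F" "b = \<Inter>G" "finite F" "F \<subseteq> B" "finite G" "G \<subseteq> B"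
      by (auto simp: E_def)
    then show "a \<inter> b \<in> E"
      unfolding E_def by (intro CollectI exI[of _ "F \<union> G"]) auto
  qed
  have 3: "UNIV \<in> E" unfolding E_def by (intro CollectI exI[of _ "{}"]) auto
  have gen: "sets borel = sigma_sets UNIV B"
    unfolding borel_eq_countable_basis[OF B] by (simp add: sets_measure_of)
  have "B \<subseteq> E"
  proof
    fix b assume "b \<in> B"
    then show "b \<in> E" unfolding E_def by (intro CollectI exI[of _ "{b}"]) auto
  qed
  moreover have "E \<subseteq> sets borel"
    using B(2) unfolding E_def
    by (auto intro!: borel_open open_Inter dest: topological_basis_open)
  ultimately have "sets borel = sigma_sets UNIV E"
    using gen by (metis sets.sigma_sets_subset sigma_sets_mono' space_borel subset_antisym)
  with 1 2 3 that show ?thesis by blast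
qed

subsection \<open>Schwartz functions and tempered distributions\<close>

text \<open>Space is cut into annuli \<open>A n\<close> of width one. The volume of
  \<open>A n\<close> is at most a constant times the d-th power of \<open>n + 1\<close>, so the
  exponent d + 2 leaves the convergent series of inverse squares.\<close>

lemma integrable_inverse_power:
  "integrable lborel (\<lambda>x::'a::euclidean_space. inverse ((1 + norm x) ^ (DIM('a) + 2)))"
proof (rule integrableI_bounded)
  let ?d = "DIM('a)"
  define c where "c = measure lborel (ball (0::'a) 1)"
  have c: "c \<ge> 0" by (simp add: c_def)
  define A where "A n = {x::'a. real n \<le> norm x \<and> norm x < real (Suc n)}" for n
  have [measurable]: "A n \<in> sets borel" for n
    unfolding A_def by measurable
  have em: "emeasure lborel (A n) \<le> ennreal (real (Suc n) ^ ?d * c)" for n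
  proof -
    have "emeasure lborel (A n) \<le> emeasure lborel (ball (0::'a) (real (Suc n)))"
      by (intro emeasure_mono) (auto simp: A_def)
    also have "\<dots> = ennreal (measure lborel (ball (0::'a) (real (Suc n))))"
      using emeasure_lborel_ball_finite[of "0::'a" "real (Suc n)"]
      by (subst emeasure_eq_ennreal_measure) auto
    also have "measure lborel (ball (0::'a) (real (Suc n))) = real (Suc n) ^ ?d * c"
      by (subst content_ball_conv_unit_ball) (auto simp: c_def)
    finally show ?thesis .
  qed
  have single: "g m \<le> (\<Sum>n. g n)" for g :: "nat \<Rightarrow> ennreal" and m
    using sum_le_suminf[of g "{m}"] by simp
  have "(\<integral>\<^sup>+x. ennreal (norm (inverse ((1 + norm (x::'a)) ^ (?d + 2)))) \<partial>lborel) \<le>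
      (\<integral>\<^sup>+x. (\<Sum>n. ennreal (inverse (real (Suc n) ^ (?d + 2))) * indicator (A n) x) \<partial>lborel)"
  proof (rule nn_integral_mono)
    fix x :: 'a
    define m where "m = nat \<lfloor>norm x\<rfloor>"
    have m: "x \<in> A m"
      unfolding A_def m_def by (auto simp: of_nat_nat) linarith+
    have "ennreal (norm (inverse ((1 + norm x) ^ (?d + 2)))) \<le>
        ennreal (inverse (real (Suc m) ^ (?d + 2))) * indicator (A m) x"
      using m by (auto simp: A_def intro!: ennreal_leI le_imp_inverse_le power_mono mult_mono)
    also have "\<dots> \<le> (\<Sum>n. ennreal (inverse (real (Suc n) ^ (?d + 2))) * indicator (A n) x)"
      by (rule single)
    finally show "ennreal (norm (inverse ((1 + norm x) ^ (?d + 2)))) \<le>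
        (\<Sum>n. ennreal (inverse (real (Suc n) ^ (?d + 2))) * indicator (A n) x)" .
  qed
  also have "\<dots> = (\<Sum>n. ennreal (inverse (real (Suc n) ^ (?d + 2))) * emeasure lborel (A n))"
    by (simp add: nn_integral_suminf nn_integral_cmult)
  also have "\<dots> \<le> (\<Sum>n. ennreal (inverse (real (Suc n) ^ (?d + 2))) * ennreal (real (Suc n) ^ ?d * c))"
    by (intro suminf_le mult_left_mono em) auto
  also have "\<dots> = (\<Sum>n. ennreal (c * inverse (real (Suc n) ^ 2)))"
  proof (intro suminf_cong)
    fix n
    have "inverse (a ^ (k + m)) * (a ^ k * c) = c * inverse (a ^ m)" if "a > 0" for a :: real and k m
      using that by (simp add: power_add field_simps)
    from this[of "real (Suc n)" ?d 2]
    have "inverse (real (Suc n) ^ (?d + 2)) * (real (Suc n) ^ ?d * c) = c * inverse (real (Suc n) ^ 2)"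
      by simp
    then show "ennreal (inverse (real (Suc n) ^ (?d + 2))) * ennreal (real (Suc n) ^ ?d * c) =
        ennreal (c * inverse (real (Suc n) ^ 2))"
      using c by (subst ennreal_mult[symmetric]) (simp_all del: of_nat_Suc power_Suc)
  qed
  also have "\<dots> < top"
  proof -
    have "summable (\<lambda>n. c * inverse (real (Suc n) ^ 2))"
      by (intro summable_mult summable_Suc_iff[THEN iffD2] inverse_power_summable) simp
    then show ?thesis
      using c by (subst suminf_ennreal2) auto
  qed
  finally show "(\<integral>\<^sup>+x. ennreal (norm (inverse ((1 + norm (x::'a)) ^ (?d + 2)))) \<partial>lborel) < \<infinity>"
    by simp
qed auto

text \<open>The explicit bound on the L^1 norm, and not only integrability, is what later yields
  continuity in the Schwartz topology.\<close>

lemma integrable_decay: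
  fixes g :: "'a::euclidean_space \<Rightarrow> complex"
  assumes "g \<in> borel_measurable borel" "\<And>x. (1 + norm x) ^ (DIM('a) + 2) * cmod (g x) \<le> C"
  shows "integrable lborel g"
    and "(LINT x|lborel. cmod (g x)) \<le>
      C * (LINT x|lborel. inverse ((1 + norm (x::'a)) ^ (DIM('a) + 2)))"
proof -
  have le: "cmod (g x) \<le> C * inverse ((1 + norm x) ^ (DIM('a) + 2))" for x
    using assms(2)[of x] by (simp add: field_simps add_pos_nonneg del: power_Suc)
  then have le': "cmod (g x) \<le> norm (C * inverse ((1 + norm x) ^ (DIM('a) + 2)))" for x
    by (smt (verit) real_norm_def)
  show "integrable lborel g"
    by (rule Bochner_Integration.integrable_bound[OF integrable_mult_right[OF integrable_inverse_power, of C]])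
      (use assms(1) le' in auto)
  then show "(LINT x|lborel. cmod (g x)) \<le>
      C * (LINT x|lborel. inverse ((1 + norm (x::'a)) ^ (DIM('a) + 2)))"
    using integral_mono[OF _ integrable_mult_right[OF integrable_inverse_power, of C] le] by simp
qed

lemma iter_partial_zero: "iter_partial bs (\<lambda>x. 0) = (\<lambda>x::'a::euclidean_space. 0::complex)"
  by (induction bs) (simp_all add: iter_partial_def frechet_derivative_const)

lemma schwartz_smooth: "\<phi> \<in> schwartz \<Longrightarrow> smooth \<phi>"
  by (simp add: schwartz_def)

lemma smooth_differentiable: "smooth f \<Longrightarrow> f differentiable (at x)"
  unfolding smooth_def by (drule bspec[of _ _ "[]"]) (auto simp: iter_partial_def)

lemma schwartz_continuous:
  assumes "\<phi> \<in> schwartz"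
  shows "continuous_on S \<phi>"
  using smooth_differentiable[OF schwartz_smooth[OF assms]]
  by (meson differentiable_imp_continuous_within continuous_at_imp_continuous_on)

lemma schwartz_borel [measurable_dest]: "\<phi> \<in> schwartz \<Longrightarrow> \<phi> \<in> borel_measurable borel"
  by (simp add: borel_measurable_continuous_onI schwartz_continuous)

lemma schwartz_bound:
  assumes "\<phi> \<in> schwartz"
  obtains C where "\<And>x. (1 + norm x) ^ k * cmod (\<phi> x) \<le> C"
proof -
  have "bdd_above (range (\<lambda>x. (1 + norm x) ^ k * cmod (iter_partial [] \<phi> x)))"
    using assms unfolding schwartz_def by (auto dest: spec[of _ k] bspec[of _ _ "[]"])
  then show ?thesis using that by (auto simp: bdd_above_def iter_partial_def)
qed

lemma schwartz_integrable:
  assumes "\<phi> \<in> schwartz"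
  shows "integrable lborel \<phi>"
proof -
  obtain C where "\<And>x. (1 + norm x) ^ (DIM('a) + 2) * cmod (\<phi> x) \<le> C"
    using schwartz_bound[OF assms] by blast
  then show ?thesis
    by (rule integrable_decay(1)[OF schwartz_borel[OF assms]])
qed

text \<open>Each Schwartz function lies in a subbasic neighbourhood centred at itself, because the
  seminorms vanish at the zero function.\<close>

lemma topspace_schwartz: "topspace schwartz_topology = schwartz"
proof -
  have "schwartz_seminorm k bs (\<lambda>x::'a. 0) = 0" for k bs
    unfolding schwartz_seminorm_def iter_partial_zero by simp
  then have "\<phi> \<in> topspace schwartz_topology" if "\<phi> \<in> schwartz" for \<phi> :: "'a \<Rightarrow> complex"
    unfolding schwartz_topology_def topology_generated_by_topspace
    using that
    by (intro UnionI[of "{\<psi>\<in>schwartz. schwartz_seminorm 0 [] (\<lambda>x. \<psi> x - \<phi> x) < 1}"] CollectI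
        exI[of _ \<phi>] exI[of _ 0] exI[of _ "[]"] exI[of _ "1::real"]) auto
  then show ?thesis
    by (auto simp: schwartz_topology_def)
qed

text \<open>A single seminorm suffices: polynomial decay of order d + 2, without derivatives,
  already controls the L^1 norm.\<close>

lemma linf_distr_tempered:
  fixes f :: "'a::euclidean_space linf"
  shows "linf_distr f \<in> tempered"
proof -
  let ?d = "DIM('a) + 2"
  define J where "J = (LINT x|lborel. inverse ((1 + norm (x::'a)) ^ ?d))"
  have J: "J \<ge> 0" unfolding J_def by (intro Bochner_Integration.integral_nonneg) simp
  have est: "cmod (linf_distr f \<psi> - linf_distr f \<phi>) \<le>
      norm f * (J * schwartz_seminorm ?d [] (\<lambda>x. \<psi> x - \<phi> x))"
    if sch: "\<phi> \<in> schwartz" "\<psi> \<in> schwartz" for \<phi> \<psi>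
  proof -
    let ?h = "\<lambda>x. \<psi> x - \<phi> x"
    obtain C where C: "\<And>x. (1 + norm x) ^ ?d * cmod (\<phi> x) \<le> C"
      using schwartz_bound[OF sch(1)] by blast
    obtain D where D: "\<And>x. (1 + norm x) ^ ?d * cmod (\<psi> x) \<le> D"
      using schwartz_bound[OF sch(2)] by blast
    have "(1 + norm x) ^ ?d * cmod (?h x) \<le> D + C" for x
    proof -
      have "(1 + norm x) ^ ?d * cmod (?h x) \<le> (1 + norm x) ^ ?d * (cmod (\<psi> x) + cmod (\<phi> x))"
        by (intro mult_left_mono norm_triangle_ineq4) auto
      then show ?thesis using C[of x] D[of x] by (simp add: distrib_left del: power_Suc)
    qed
    \<comment> \<open>A supremum of reals is an upper bound only once the set is known to be bounded
      above.\<close>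
    then have "bdd_above (range (\<lambda>x. (1 + norm x) ^ ?d * cmod (?h x)))"
      by (auto simp: bdd_above_def)
    then have "(1 + norm x) ^ ?d * cmod (?h x) \<le> schwartz_seminorm ?d [] ?h" for x
      unfolding schwartz_seminorm_def iter_partial_def by (auto intro!: cSUP_upper)
    then have "(LINT x|lborel. cmod (?h x)) \<le> schwartz_seminorm ?d [] ?h * J"
      unfolding J_def using that by (intro integrable_decay(2)) (auto intro: schwartz_borel)
    moreover have "linf_distr f \<psi> - linf_distr f \<phi> = linf_distr f ?h"
      using that linf_distr_arg_add[of ?h \<phi> f] by (simp add: schwartz_integrable)
    moreover have "cmod (linf_distr f ?h) \<le> norm f * (LINT x|lborel. cmod (?h x))"
      using that by (intro linf_distr_bound) (simp add: schwartz_integrable)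
    ultimately show ?thesis
      by (smt (verit) mult.commute mult_left_mono norm_ge_zero)
  qed
  have "continuous_map schwartz_topology euclidean (linf_distr f)"
    unfolding continuous_map_def
  proof (intro conjI allI impI)
    fix U :: "complex set" assume "openin euclidean U"
    then have U: "open U" by simp
    let ?P = "{\<psi> \<in> topspace schwartz_topology. linf_distr f \<psi> \<in> U}"
    show "openin schwartz_topology ?P"
    proof (subst openin_subopen, intro ballI)
      fix \<phi> assume "\<phi> \<in> ?P"
      then have \<phi>: "\<phi> \<in> schwartz" "linf_distr f \<phi> \<in> U" by (auto simp: topspace_schwartz)
      obtain e where e: "e > 0" "ball (linf_distr f \<phi>) e \<subseteq> U"
        using U \<phi>(2) open_contains_ball by blast
      \<comment> \<open>Adding 1 keeps the radius \<open>e / K\<close> meaningful when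
        \<open>f\<close> is zero and makes the final estimate strict.\<close>
      define K where "K = norm f * J + 1"
      have K: "K > 0" using J by (simp add: K_def add_nonneg_pos)
      let ?N = "{\<psi>\<in>schwartz. schwartz_seminorm ?d [] (\<lambda>x. \<psi> x - \<phi> x) < e / K}"
      have "openin schwartz_topology ?N"
        unfolding schwartz_topology_def using \<phi> e K
        by (intro topology_generated_by_Basis CollectI exI[of _ \<phi>] exI[of _ ?d] exI[of _ "[]"]
            exI[of _ "e / K"]) auto
      moreover have "\<phi> \<in> ?N"
        using \<phi> e K by (simp add: schwartz_seminorm_def iter_partial_zero)
      moreover have "?N \<subseteq> ?P"
      proof
        fix \<psi> assume \<psi>: "\<psi> \<in> ?N"
        let ?s = "schwartz_seminorm ?d [] (\<lambda>x. \<psi> x - \<phi> x)"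
        have "cmod (linf_distr f \<psi> - linf_distr f \<phi>) \<le> (norm f * J) * ?s"
          using est[of \<phi> \<psi>] \<phi> \<psi> by (simp add: mult.assoc)
        also have "\<dots> \<le> (norm f * J) * (e / K)"
          using \<psi> J by (intro mult_left_mono) auto
        also have "\<dots> < e"
          using K e by (simp add: K_def field_simps)
        finally show "\<psi> \<in> ?P"
          using \<psi> e(2) by (auto simp: topspace_schwartz dist_norm norm_minus_commute)
      qed
      ultimately show "\<exists>T. openin schwartz_topology T \<and> \<phi> \<in> T \<and> T \<subseteq> ?P" by blast
    qed
  qed auto
  then show ?thesis
    by (auto simp: tempered_def linf_distr_arg_add linf_distr_arg_cmult schwartz_integrable
        schwartz_borel)
qed

text \<open>Temperedness is automatic for bounded functions, which leaves the decay condition;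
  cutoff and Fourier transform act on the test function by duality.\<close>

lemma Sh_linf_iff:
  "f \<in> Sh_linf chi \<longleftrightarrow> (\<forall>\<phi>\<in>schwartz.
     ((\<lambda>l. linf_distr f (fourier (\<lambda>\<xi>. of_real (chi (l *\<^sub>R \<xi>)) * \<phi> \<xi>))) \<longlongrightarrow> 0) at_top)"
  by (simp add: Sh_linf_def Sh'_def linf_distr_tempered tempered_tendsto_def mult_distr_def
      fourier_distr_def)

subsection \<open>Differentiable functions with compact support\<close>

text \<open>Finite-order counterpart of \<open>smooth\<close>. The recursion peels off the
  derivative taken first, whereas the head of the list in \<open>iter_partial\<close> is the one
  taken last; this form suits inductions over \<open>n\<close> with \<open>f\<close>
  arbitrary.\<close>

primrec diff_order :: "nat \<Rightarrow> ('a::euclidean_space \<Rightarrow> 'b::real_normed_vector) \<Rightarrow> bool" where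
  "diff_order 0 f \<longleftrightarrow> (\<forall>x. f differentiable (at x))"
| "diff_order (Suc n) f \<longleftrightarrow> (\<forall>x. f differentiable (at x)) \<and>
     (\<forall>b\<in>Basis. diff_order n (\<lambda>x. frechet_derivative f (at x) b))"

lemma diff_order_differentiable: "diff_order n f \<Longrightarrow> f differentiable (at x)"
  by (cases n) auto

lemma diff_order_has_derivative:
  "diff_order n f \<Longrightarrow> (f has_derivative frechet_derivative f (at x)) (at x)"
  using diff_order_differentiable frechet_derivative_works by blast

lemma diff_order_continuous:
  assumes "diff_order n f"
  shows "continuous_on S f"
  using diff_order_differentiable[OF assms]
  by (meson differentiable_imp_continuous_within continuous_at_imp_continuous_on)

lemma diff_order_SucD: "diff_order (Suc n) f \<Longrightarrow> diff_order n f"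
  by (induction n arbitrary: f) auto

lemma iter_partial_snoc:
  "iter_partial (bs @ [b]) f = iter_partial bs (\<lambda>x. frechet_derivative f (at x) b)"
  by (simp add: iter_partial_def)

lemma smooth_diff_order: "smooth f \<Longrightarrow> diff_order n f"
proof (induction n arbitrary: f)
  case 0
  then show ?case by (simp add: smooth_differentiable)
next
  case (Suc n)
  have "smooth (\<lambda>x. frechet_derivative f (at x) b)" if "b \<in> Basis" for b
    unfolding smooth_def
  proof (intro ballI)
    fix bs :: "'a list" assume "bs \<in> lists Basis"
    then have "bs @ [b] \<in> lists Basis" using that by simp
    then have "\<forall>x. iter_partial (bs @ [b]) f differentiable (at x)"
      using Suc.prems unfolding smooth_def by blast
    then show "\<forall>x. iter_partial bs (\<lambda>x. frechet_derivative f (at x) b) differentiable (at x)"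
      by (simp add: iter_partial_snoc)
  qed
  then show ?case using Suc by (simp add: smooth_differentiable)
qed

lemma diff_order_add:
  "diff_order n f \<Longrightarrow> diff_order n g \<Longrightarrow> diff_order n (\<lambda>x. f x + g x)"
proof (induction n arbitrary: f g)
  case (Suc n)
  have "frechet_derivative (\<lambda>x. f x + g x) (at x) =
      (\<lambda>h. frechet_derivative f (at x) h + frechet_derivative g (at x) h)" for x
    by (intro frechet_derivative_at[symmetric] has_derivative_add
        diff_order_has_derivative[OF Suc.prems(1)] diff_order_has_derivative[OF Suc.prems(2)])
  with Suc show ?case by simp
qed simp

lemma diff_order_mult:
  fixes f g :: "'a::euclidean_space \<Rightarrow> complex"
  shows "diff_order n f \<Longrightarrow> diff_order n g \<Longrightarrow> diff_order n (\<lambda>x. f x * g x)"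
proof (induction n arbitrary: f g)
  case (Suc n)
  have "frechet_derivative (\<lambda>x. f x * g x) (at x) =
      (\<lambda>h. f x * frechet_derivative g (at x) h + frechet_derivative f (at x) h * g x)" for x
    by (intro frechet_derivative_at[symmetric] has_derivative_mult
        diff_order_has_derivative[OF Suc.prems(1)] diff_order_has_derivative[OF Suc.prems(2)])
  moreover have "diff_order n f" "diff_order n g"
    using Suc.prems by (auto intro: diff_order_SucD)
  ultimately show ?case using Suc by (auto intro!: diff_order_add)
qed simp

text \<open>The scalar \<open>c\<close> is there for the induction: every derivative produces a
  further factor \<open>l\<close>.\<close>

lemma diff_order_scale:
  "diff_order n f \<Longrightarrow> diff_order n (\<lambda>x. c *\<^sub>R f (l *\<^sub>R x))"
proof (induction n arbitrary: f c)
  case 0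
  have "((\<lambda>x. c *\<^sub>R f (l *\<^sub>R x)) has_derivative
      (\<lambda>h. c *\<^sub>R frechet_derivative f (at (l *\<^sub>R x)) (l *\<^sub>R h))) (at x)" for x
    by (intro has_derivative_scaleR_right has_derivative_compose[OF _ diff_order_has_derivative[OF 0]]
        has_derivative_ident)
  then show ?case by (auto simp: differentiable_def)
next
  case (Suc n)
  have D: "((\<lambda>x. c *\<^sub>R f (l *\<^sub>R x)) has_derivative
      (\<lambda>h. c *\<^sub>R frechet_derivative f (at (l *\<^sub>R x)) (l *\<^sub>R h))) (at x)" for c x
    by (intro has_derivative_scaleR_right has_derivative_compose[OF _ diff_order_has_derivative[OF Suc.prems]]
        has_derivative_ident)
  have "frechet_derivative (\<lambda>x. c *\<^sub>R f (l *\<^sub>R x)) (at x) h =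
      (c * l) *\<^sub>R frechet_derivative f (at (l *\<^sub>R x)) h" for x h
    using fun_cong[OF frechet_derivative_at[OF D], of c x h]
      linear_scale[OF has_derivative_linear[OF diff_order_has_derivative[OF Suc.prems]], of "l *\<^sub>R x" l h]
    by simp
  moreover have "diff_order n (\<lambda>x. (c * l) *\<^sub>R frechet_derivative f (at (l *\<^sub>R x)) b)"
    if "b \<in> Basis" for b
    using Suc.prems that by (intro Suc.IH) simp
  moreover have "(\<lambda>x. c *\<^sub>R f (l *\<^sub>R x)) differentiable (at x)" for x
    using D by (rule differentiableI)
  ultimately show ?case by simp
qed

lemma diff_order_of_real:
  fixes f :: "'a::euclidean_space \<Rightarrow> real"
  shows "diff_order n f \<Longrightarrow> diff_order n (\<lambda>x. complex_of_real (f x))"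
proof (induction n arbitrary: f)
  case 0
  then show ?case
    using has_derivative_of_real[OF diff_order_has_derivative[OF 0]] by (auto simp: differentiable_def)
next
  case (Suc n)
  have D: "((\<lambda>x. complex_of_real (f x)) has_derivative
      (\<lambda>h. complex_of_real (frechet_derivative f (at x) h))) (at x)" for x
    by (intro has_derivative_of_real diff_order_has_derivative[OF Suc.prems])
  then show ?case
    using Suc by (auto simp: differentiable_def frechet_derivative_at[OF D, symmetric])
qed

text \<open>The exterior of a closed ball is open, so \<open>f\<close> agrees with zero near
  \<open>x\<close>.\<close>

lemma frechet_derivative_zero_outside:
  assumes "\<And>x::'a::euclidean_space. norm x > R \<Longrightarrow> f x = 0" "norm x > R"
  shows "frechet_derivative f (at x) b = 0"
proof -
  have "open {x::'a. norm x > R}"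
    by (intro open_Collect_less continuous_intros)
  then have "(f has_derivative (\<lambda>h. 0)) (at x)"
    by (rule has_derivative_transform_within_open[OF has_derivative_const[of 0]])
      (use assms in auto)
  then show ?thesis
    using frechet_derivative_at by metis
qed

lemma integrable_compact_support:
  fixes f :: "'a::euclidean_space \<Rightarrow> complex"
  assumes "continuous_on UNIV f" "\<And>x. norm x > R \<Longrightarrow> f x = 0"
  shows "integrable lborel f"
proof -
  have "integrable lborel (\<lambda>x. indicator (cball 0 R) x *\<^sub>R f x)"
    by (intro borel_integrable_compact) (auto intro: continuous_on_subset[OF assms(1)])
  moreover have "(\<lambda>x. indicator (cball 0 R) x *\<^sub>R f x) = f"
    using assms(2) by (auto simp: indicator_def fun_eq_iff)
  ultimately show ?thesis by simp
qed

lemma bounded_compact_support: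
  fixes f :: "'a::euclidean_space \<Rightarrow> complex"
  assumes "continuous_on UNIV f" "\<And>x. norm x > R \<Longrightarrow> f x = 0"
  obtains M where "M \<ge> 0" "\<And>x. cmod (f x) \<le> M"
proof -
  have "compact (f ` cball 0 R)"
    by (intro compact_continuous_image continuous_on_subset[OF assms(1)]) auto
  then obtain M where M: "\<And>x. x \<in> cball 0 R \<Longrightarrow> cmod (f x) \<le> M"
    by (meson bounded_iff compact_imp_bounded imageI)
  have "cmod (f x) \<le> max M 0" for x
    using M[of x] assms(2)[of x] by (cases "norm x \<le> R") auto
  then show ?thesis using that[of "max M 0"] by auto
qed

text \<open>Translation invariance gives difference quotients integral zero; pass to the limit.\<close>

lemma integral_partial_derivative_zero:
  fixes u :: "'a::euclidean_space \<Rightarrow> complex"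
  assumes der: "\<And>x. (u has_derivative u' x) (at x)"
    and cont: "continuous_on UNIV (\<lambda>x. u' x b)"
    and b: "norm b = 1"
    and supp: "\<And>x. norm x > R \<Longrightarrow> u x = 0"
  shows "(LINT x|lborel. u' x b) = 0"
proof -
  have ucont: "continuous_on UNIV u"
    using der by (meson continuous_at_imp_continuous_on has_derivative_continuous)
  have supp': "u' x b = 0" if "norm x > R" for x
    using frechet_derivative_zero_outside[of R u, OF supp that, of b] frechet_derivative_at[OF der[of x]]
    by simp
  obtain M where M: "M \<ge> 0" "\<And>x. cmod (u' x b) \<le> M"
    using bounded_compact_support[OF cont supp'] by blast
  \<comment> \<open>Mean value inequality along the line in direction \<open>b\<close>; it bounds
    all difference quotients by \<open>M\<close>.\<close>
  have lip: "cmod (u (x + t *\<^sub>R b) - u x) \<le> M * t" if "t \<ge> 0" for x t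
  proof -
    have "norm (u (x + t *\<^sub>R b) - u (x + 0 *\<^sub>R b)) \<le> M * norm (t - 0)"
    proof (rule differentiable_bound[of UNIV "\<lambda>s. u (x + s *\<^sub>R b)" "\<lambda>s h. u' (x + s *\<^sub>R b) (h *\<^sub>R b)"])
      fix s :: real
      show "((\<lambda>s. u (x + s *\<^sub>R b)) has_derivative (\<lambda>h. u' (x + s *\<^sub>R b) (h *\<^sub>R b))) (at s within UNIV)"
        by (rule has_derivative_compose[OF _ der]) (auto intro!: derivative_eq_intros)
      show "onorm (\<lambda>h. u' (x + s *\<^sub>R b) (h *\<^sub>R b)) \<le> M"
      proof (rule onorm_le)
        fix h :: real
        have "u' (x + s *\<^sub>R b) (h *\<^sub>R b) = h *\<^sub>R u' (x + s *\<^sub>R b) b"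
          by (rule linear_scale[OF has_derivative_linear[OF der]])
        then show "norm (u' (x + s *\<^sub>R b) (h *\<^sub>R b)) \<le> M * norm h"
          using mult_right_mono[OF M(2)[of "x + s *\<^sub>R b"], of "\<bar>h\<bar>"] by (simp add: mult.commute)
      qed
    qed auto
    then show ?thesis using that by simp
  qed
  define q where "q n x = real (Suc n) *\<^sub>R (u (x + (1 / real (Suc n)) *\<^sub>R b) - u x)" for n x
  have uint: "integrable lborel u"
    by (rule integrable_compact_support[OF ucont supp])
  have trans: "integrable lborel (\<lambda>x. u (x + c))" "(LINT x|lborel. u (x + c)) = (LINT x|lborel. u x)" for c
  proof -
    have um: "u \<in> borel_measurable borel" using uint by auto
    have "integrable (distr lborel borel ((+) c)) u" using uint by (simp add: lborel_distr_plus)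
    then show "integrable lborel (\<lambda>x. u (x + c))"
      using um by (subst (asm) integrable_distr_eq) (auto simp: add.commute)
    have "(LINT x|lborel. u x) = (LINT x|distr lborel borel ((+) c). u x)"
      by (simp add: lborel_distr_plus)
    also have "\<dots> = (LINT x|lborel. u (x + c))"
      using um by (subst integral_distr) (auto simp: add.commute)
    finally show "(LINT x|lborel. u (x + c)) = (LINT x|lborel. u x)" by simp
  qed
  \<comment> \<open>The increments are at most 1, so all quotients vanish outside the ball of radius
    \<open>R + 1\<close>; together with the bound \<open>M\<close> this gives an integrable
    majorant.\<close>
  have "(\<lambda>n. LINT x|lborel. q n x) \<longlonglongrightarrow> (LINT x|lborel. u' x b)"
  proof (rule integral_dominated_convergence[where w = "\<lambda>x. M * indicator (cball 0 (R + 1)) x"])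
    show "(\<lambda>x. u' x b) \<in> borel_measurable lborel"
      using borel_measurable_continuous_onI[OF cont] by simp
    show "q n \<in> borel_measurable lborel" for n
      unfolding q_def using trans(1) uint by (intro borel_measurable_integrable) auto
    show "integrable lborel (\<lambda>x. M * indicator (cball 0 (R + 1)) x)"
      by (intro integrable_mult_right integrable_real_indicator emeasure_bounded_finite) auto
    show "AE x in lborel. (\<lambda>n. q n x) \<longlonglongrightarrow> u' x b"
    proof (rule AE_I2)
      fix x
      let ?h = "\<lambda>n. (1 / real (Suc n)) *\<^sub>R b"
      have "?h \<longlonglongrightarrow> 0 *\<^sub>R b"
        by (intro tendsto_scaleR tendsto_const LIMSEQ_Suc[OF lim_1_over_n])
      \<comment> \<open>As \<open>b\<close> has norm one, the increments tend to zero without ever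
        being zero.\<close>
      then have "filterlim ?h (at 0) sequentially"
        unfolding filterlim_at using b by (auto intro!: always_eventually)
      moreover have "(\<lambda>h. norm (u (x + h) - u x - u' x h) / norm h) \<midarrow>0\<rightarrow> 0"
        using der[of x] by (simp add: has_derivative_at)
      ultimately have "(\<lambda>n. norm (u (x + ?h n) - u x - u' x (?h n)) / norm (?h n)) \<longlonglongrightarrow> 0"
        by (rule filterlim_compose[rotated])
      moreover have "norm (u (x + ?h n) - u x - u' x (?h n)) / norm (?h n) = norm (q n x - u' x b)" for n
      proof -
        have "u' x (?h n) = (1 / real (Suc n)) *\<^sub>R u' x b"
          by (rule linear_scale[OF has_derivative_linear[OF der]])
        then have "q n x - u' x b = real (Suc n) *\<^sub>R (u (x + ?h n) - u x - u' x (?h n))"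
          by (simp add: q_def scaleR_diff_right del: of_nat_Suc)
        then show ?thesis
          using b by (simp add: mult.commute del: of_nat_Suc)
      qed
      ultimately show "(\<lambda>n. q n x) \<longlonglongrightarrow> u' x b"
        by (simp add: tendsto_norm_zero_iff LIM_zero_iff)
    qed
    show "AE x in lborel. norm (q n x) \<le> M * indicator (cball 0 (R + 1)) x" for n
    proof (rule AE_I2)
      fix x
      have t: "norm ((1 / real (Suc n)) *\<^sub>R b) \<le> 1" using b by simp
      show "norm (q n x) \<le> M * indicator (cball 0 (R + 1)) x"
      proof (cases "norm x \<le> R + 1")
        case True
        have "norm (q n x) \<le> real (Suc n) * (M * (1 / real (Suc n)))"
          unfolding q_def norm_scaleR by (intro mult_mono lip) auto
        then show ?thesis using True by (simp del: of_nat_Suc)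
      next
        case False
        then have "norm (x + (1 / real (Suc n)) *\<^sub>R b) > R"
          using t norm_triangle_ineq2[of x "- ((1 / real (Suc n)) *\<^sub>R b)"]
          by (simp del: of_nat_Suc norm_scaleR)
        then show ?thesis using False M by (simp add: q_def supp)
      qed
    qed
  qed
  moreover have "(LINT x|lborel. q n x) = 0" for n
    unfolding q_def using uint trans by simp
  ultimately show ?thesis
    by (simp add: LIMSEQ_const_iff)
qed

subsection \<open>The Fourier transform of compactly supported functions\<close>

lemma integrable_cis_mult:
  assumes "integrable lborel (\<psi> :: 'a::euclidean_space \<Rightarrow> complex)"
  shows "integrable lborel (\<lambda>x. cis (- (x \<bullet> \<xi>)) * \<psi> x)"
proof (rule Bochner_Integration.integrable_bound[OF assms])
  have "(\<lambda>x::'a. cis (- (x \<bullet> \<xi>))) \<in> borel_measurable borel"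
    by (intro borel_measurable_continuous_onI continuous_intros)
  then show "(\<lambda>x. cis (- (x \<bullet> \<xi>)) * \<psi> x) \<in> borel_measurable lborel"
    using assms by auto
qed (simp add: norm_mult)

lemma cmod_fourier_le: "cmod (fourier \<psi> \<xi>) \<le> (LINT x|lborel. cmod (\<psi> x))"
  unfolding fourier_def
  using integral_norm_bound[of lborel "\<lambda>x. cis (- (x \<bullet> \<xi>)) * \<psi> x"] by (simp add: norm_mult)

lemma fourier_continuous:
  fixes \<psi> :: "'a::euclidean_space \<Rightarrow> complex"
  assumes "integrable lborel \<psi>"
  shows "continuous_on S (fourier \<psi>)"
proof (intro continuous_at_imp_continuous_on ballI)
  fix \<xi> :: 'a
  show "isCont (fourier \<psi>) \<xi>"
    unfolding continuous_at_sequentially comp_def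
  proof (intro allI impI)
    fix X assume X: "X \<longlonglongrightarrow> \<xi>"
    show "(\<lambda>n. fourier \<psi> (X n)) \<longlonglongrightarrow> fourier \<psi> \<xi>"
      unfolding fourier_def
    proof (rule integral_dominated_convergence[where w = "\<lambda>x. cmod (\<psi> x)"])
      show "AE x in lborel. (\<lambda>n. cis (- (x \<bullet> X n)) * \<psi> x) \<longlonglongrightarrow> cis (- (x \<bullet> \<xi>)) * \<psi> x"
      proof (intro AE_I2 tendsto_mult tendsto_const)
        fix x
        have "isCont (\<lambda>y. cis (- (x \<bullet> y))) \<xi>"
          by (rule continuous_on_interior[of UNIV]) (auto intro!: continuous_intros)
        then show "(\<lambda>n. cis (- (x \<bullet> X n))) \<longlonglongrightarrow> cis (- (x \<bullet> \<xi>))"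
          using X by (rule isCont_tendsto_compose)
      qed
    qed (use assms integrable_cis_mult[OF assms] in \<open>auto simp: norm_mult\<close>)
  qed
qed

text \<open>Integration by parts: the product of the character with \<open>\<psi>\<close> has
  compact support, so its derivative in direction \<open>b\<close> integrates to zero, and the
  product rule splits this integral into the two sides.\<close>

lemma fourier_partial:
  fixes \<psi> :: "'a::euclidean_space \<Rightarrow> complex"
  assumes \<psi>: "diff_order (Suc n) \<psi>" "\<And>x. norm x > R \<Longrightarrow> \<psi> x = 0" and b: "b \<in> Basis"
  shows "fourier (\<lambda>x. frechet_derivative \<psi> (at x) b) \<xi> = \<i> * of_real (\<xi> \<bullet> b) * fourier \<psi> \<xi>"
proof -
  let ?D = "\<lambda>x. frechet_derivative \<psi> (at x)"
  let ?e = "\<lambda>x. cis (- (x \<bullet> \<xi>))"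
  have D: "(\<psi> has_derivative ?D x) (at x)" for x
    by (rule diff_order_has_derivative[OF \<psi>(1)])
  have Db: "continuous_on UNIV (\<lambda>x. ?D x b)"
    using \<psi>(1) b by (auto intro: diff_order_continuous)
  have \<psi>c: "continuous_on UNIV \<psi>"
    using \<psi>(1) by (rule diff_order_continuous)
  have int: "integrable lborel \<psi>" "integrable lborel (\<lambda>x. ?D x b)"
    using integrable_compact_support[OF \<psi>c \<psi>(2)]
      integrable_compact_support[OF Db frechet_derivative_zero_outside[OF \<psi>(2)]] by auto
  have "(LINT x|lborel. ?e x * ?D x b + (- (b \<bullet> \<xi>)) *\<^sub>R (\<i> * ?e x) * \<psi> x) = 0"
  proof (rule integral_partial_derivative_zero[of "\<lambda>x. ?e x * \<psi> x"
        "\<lambda>x h. ?e x * ?D x h + (- (h \<bullet> \<xi>)) *\<^sub>R (\<i> * ?e x) * \<psi> x"])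
    show "((\<lambda>x. ?e x * \<psi> x) has_derivative
        (\<lambda>h. ?e x * ?D x h + (- (h \<bullet> \<xi>)) *\<^sub>R (\<i> * ?e x) * \<psi> x)) (at x)" for x
      by (intro has_derivative_mult D has_derivative_cis has_derivative_minus has_derivative_inner_left
          has_derivative_ident)
    show "continuous_on UNIV (\<lambda>x. ?e x * ?D x b + (- (b \<bullet> \<xi>)) *\<^sub>R (\<i> * ?e x) * \<psi> x)"
      by (intro continuous_intros Db \<psi>c)
  qed (use \<psi> b in auto)
  also have "(\<lambda>x. ?e x * ?D x b + (- (b \<bullet> \<xi>)) *\<^sub>R (\<i> * ?e x) * \<psi> x) =
      (\<lambda>x. ?e x * ?D x b - \<i> * of_real (\<xi> \<bullet> b) * (?e x * \<psi> x))"
    by (auto simp: scaleR_conv_of_real inner_commute)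
  finally show ?thesis
    using integrable_cis_mult[OF int(1), of \<xi>] integrable_cis_mult[OF int(2), of \<xi>]
    by (simp add: fourier_def)
qed

text \<open>Each order of differentiability is traded for one power of the
  \<open>b\<close>-coordinate; a partial derivative still vanishes outside radius \<open>R\<close>,
  so the argument iterates.\<close>

lemma fourier_decay_direction:
  fixes \<psi> :: "'a::euclidean_space \<Rightarrow> complex"
  assumes "diff_order n \<psi>" "\<And>x. norm x > R \<Longrightarrow> \<psi> x = 0" "b \<in> Basis"
  shows "\<exists>C. \<forall>\<xi>. \<bar>\<xi> \<bullet> b\<bar> ^ n * cmod (fourier \<psi> \<xi>) \<le> C"
  using assms(1,2)
proof (induction n arbitrary: \<psi>)
  case 0
  then show ?case using cmod_fourier_le[of \<psi>] by auto
next
  case (Suc n)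
  let ?D = "\<lambda>x. frechet_derivative \<psi> (at x) b"
  have "\<exists>C. \<forall>\<xi>. \<bar>\<xi> \<bullet> b\<bar> ^ n * cmod (fourier ?D \<xi>) \<le> C"
    using Suc.prems assms(3) by (intro Suc.IH) (auto intro: frechet_derivative_zero_outside)
  moreover have "cmod (fourier ?D \<xi>) = \<bar>\<xi> \<bullet> b\<bar> * cmod (fourier \<psi> \<xi>)" for \<xi>
    using fourier_partial[OF Suc.prems assms(3), where \<xi> = \<xi>] by (simp add: norm_mult)
  ultimately show ?case by (simp add: mult_ac)
qed

text \<open>Some coordinate of a vector is at least its norm divided by d, so decay along the
  coordinate directions gives decay in the norm. Order d + 2 is what integrability asks for
  here.\<close>

lemma fourier_integrable:
  fixes \<psi> :: "'a::euclidean_space \<Rightarrow> complex"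
  assumes "diff_order (DIM('a) + 2) \<psi>" "\<And>x. norm x > R \<Longrightarrow> \<psi> x = 0"
  shows "integrable lborel (fourier \<psi>)"
proof -
  let ?n = "DIM('a) + 2"
  have int: "integrable lborel \<psi>"
    by (rule integrable_compact_support[OF diff_order_continuous[OF assms(1)] assms(2)])
  have "\<forall>b\<in>Basis. \<exists>C. \<forall>\<xi>. \<bar>\<xi> \<bullet> b\<bar> ^ ?n * cmod (fourier \<psi> \<xi>) \<le> C"
    using fourier_decay_direction[OF assms] by blast
  then obtain C where C: "\<And>b \<xi>. b \<in> Basis \<Longrightarrow> \<bar>\<xi> \<bullet> b\<bar> ^ ?n * cmod (fourier \<psi> \<xi>) \<le> C b"
    by metis
  define C0 where "C0 = (LINT x|lborel. cmod (\<psi> x))"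
  define K where "K = (\<Sum>b\<in>Basis. \<bar>C b\<bar>)"
  \<comment> \<open>The two summands of the bound serve frequencies of norm at most 1 and above 1
    respectively.\<close>
  have "(1 + norm \<xi>) ^ ?n * cmod (fourier \<psi> \<xi>) \<le> 2 ^ ?n * C0 + (2 * real DIM('a)) ^ ?n * K" for \<xi> :: 'a
  proof (cases "norm \<xi> \<le> 1")
    case True
    have "(1 + norm \<xi>) ^ ?n * cmod (fourier \<psi> \<xi>) \<le> 2 ^ ?n * C0"
      unfolding C0_def using True by (intro mult_mono power_mono cmod_fourier_le) auto
    moreover have "K \<ge> 0" by (auto simp: K_def intro: sum_nonneg)
    ultimately show ?thesis by (smt (verit) zero_le_mult_iff zero_le_power of_nat_0_le_iff)
  next
    case False
    \<comment> \<open>Pigeonhole on the l^1 norm: if all coordinates were smaller than this, their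
      sum would fall below the norm.\<close>
    obtain b where b: "b \<in> Basis" "norm \<xi> \<le> DIM('a) * \<bar>\<xi> \<bullet> b\<bar>"
    proof (rule ccontr)
      assume "\<not> thesis"
      then have "\<bar>\<xi> \<bullet> b\<bar> < norm \<xi> / DIM('a)" if "b \<in> Basis" for b
        using \<open>\<And>b. b \<in> Basis \<Longrightarrow> norm \<xi> \<le> DIM('a) * \<bar>\<xi> \<bullet> b\<bar> \<Longrightarrow> thesis\<close> that
        by (force simp: field_simps not_le)
      then have "(\<Sum>b\<in>Basis. \<bar>\<xi> \<bullet> b\<bar>) < (\<Sum>b\<in>(Basis::'a set). norm \<xi> / DIM('a))"
        by (intro sum_strict_mono) auto
      then show False using norm_le_l1[of \<xi>] by simp
    qed
    \<comment> \<open>Here \<open>1 + norm \<xi>\<close> is at most twice the norm, hence the factor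
      2 beside the dimension.\<close>
    have "(1 + norm \<xi>) ^ ?n * cmod (fourier \<psi> \<xi>) \<le>
        ((2 * real DIM('a)) * \<bar>\<xi> \<bullet> b\<bar>) ^ ?n * cmod (fourier \<psi> \<xi>)"
      using False b by (intro mult_right_mono power_mono) auto
    also have "\<dots> = (2 * real DIM('a)) ^ ?n * (\<bar>\<xi> \<bullet> b\<bar> ^ ?n * cmod (fourier \<psi> \<xi>))"
      by (simp only: power_mult_distrib mult.assoc)
    also have "\<dots> \<le> (2 * real DIM('a)) ^ ?n * K"
    proof (rule mult_left_mono)
      have "\<bar>C b\<bar> \<le> K" unfolding K_def using b by (intro member_le_sum) auto
      then show "\<bar>\<xi> \<bullet> b\<bar> ^ ?n * cmod (fourier \<psi> \<xi>) \<le> K"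
        using C[OF b(1), of \<xi>] by linarith
    qed auto
    also have "\<dots> \<le> 2 ^ ?n * C0 + (2 * real DIM('a)) ^ ?n * K"
      by (simp add: C0_def)
    finally show ?thesis .
  qed
  then show ?thesis
    by (intro integrable_decay(1) borel_measurable_continuous_onI fourier_continuous int)
qed

lemma lborel_integral_scale:
  fixes g :: "'a::euclidean_space \<Rightarrow> complex"
  assumes "g \<in> borel_measurable borel" "l > 0"
  shows "(LINT x|lborel. g x) = of_real (l ^ DIM('a)) * (LINT x|lborel. g (l *\<^sub>R x))"
proof -
  have "(LINT x|lborel. g x) =
      (LINT x|density (distr lborel borel (\<lambda>x. 0 + l *\<^sub>R x)) (\<lambda>_. ennreal (\<bar>l\<bar> ^ DIM('a))). g x)"
    using lborel_affine[of l "0::'a"] assms by simp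
  also have "\<dots> = of_real (l ^ DIM('a)) * (LINT x|lborel. g (l *\<^sub>R x))"
    using assms
    by (subst integral_density) (auto simp: integral_distr scaleR_conv_of_real)
  finally show ?thesis .
qed

lemma fourier_scale:
  fixes \<psi> :: "'a::euclidean_space \<Rightarrow> complex"
  assumes [measurable]: "\<psi> \<in> borel_measurable borel" and l: "l > 0"
  shows "fourier (\<lambda>\<xi>. \<psi> (l *\<^sub>R \<xi>)) x = fourier \<psi> (x /\<^sub>R l) / of_real (l ^ DIM('a))"
proof -
  have [measurable]: "(\<lambda>\<xi>. cis (- (\<xi> \<bullet> (x /\<^sub>R l)))) \<in> borel_measurable borel"
    by (intro borel_measurable_continuous_onI continuous_intros)
  have "fourier \<psi> (x /\<^sub>R l) = of_real (l ^ DIM('a)) *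
      (LINT \<xi>|lborel. cis (- ((l *\<^sub>R \<xi>) \<bullet> (x /\<^sub>R l))) * \<psi> (l *\<^sub>R \<xi>))"
    unfolding fourier_def by (rule lborel_integral_scale) (use l in measurable)
  also have "\<dots> = of_real (l ^ DIM('a)) * fourier (\<lambda>\<xi>. \<psi> (l *\<^sub>R \<xi>)) x"
    using l by (simp add: fourier_def mult.assoc[symmetric])
  finally show ?thesis using l by simp
qed

subsection \<open>The low frequency cutoff\<close>

context
  fixes chi :: "'a::euclidean_space \<Rightarrow> real"
  assumes chi: "low_freq_cutoff chi"
begin

lemma cutoff_zero:
  assumes "norm x > 2"
  shows "chi x = 0"
proof (rule ccontr)
  assume "chi x \<noteq> 0"
  then have "x \<in> closure {x. chi x \<noteq> 0}" by (intro closure_subset[THEN subsetD]) simp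
  moreover have "closure {x. chi x \<noteq> 0} \<subseteq> cball 0 2"
    using chi unfolding low_freq_cutoff_def by blast
  ultimately have "x \<in> cball 0 2" by (rule rev_subsetD)
  then show False using assms by simp
qed

lemma cutoff_one:
  assumes "norm x \<le> 1"
  shows "chi x = 1"
proof -
  obtain U where U: "cball 0 1 \<subseteq> U" "\<forall>x\<in>U. chi x = 1"
    using chi unfolding low_freq_cutoff_def by blast
  have "x \<in> cball 0 1" using assms by simp
  with U show ?thesis by blast
qed

text \<open>Along each ray \<open>chi\<close> is nonincreasing, from 1 at the origin to 0 beyond
  radius 2.\<close>

lemma cutoff_range: "0 \<le> chi x" "chi x \<le> 1"
proof -
  have "0 \<le> chi x \<and> chi x \<le> 1"
  proof (cases "x = 0")
    case True
    then show ?thesis by (simp add: cutoff_one)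
  next
    case False
    define e where "e = x /\<^sub>R norm x"
    have e: "norm e = 1" "norm x *\<^sub>R e = x" using False by (auto simp: e_def)
    then have anti: "antimono_on {0..} (\<lambda>r. chi (r *\<^sub>R e))"
      using chi unfolding low_freq_cutoff_def by blast
    have "chi (norm x *\<^sub>R e) \<le> chi (0 *\<^sub>R e)"
      using anti by (rule monotone_onD) auto
    \<comment> \<open>Any radius above 2 and beyond \<open>norm x\<close> would do; adding 3 meets
      both demands.\<close>
    moreover have "chi ((norm x + 3) *\<^sub>R e) \<le> chi (norm x *\<^sub>R e)"
      using anti by (rule monotone_onD) auto
    moreover have "chi ((norm x + 3) *\<^sub>R e) = 0"
      using e by (intro cutoff_zero) (simp add: add_pos_nonneg)
    ultimately show ?thesis using e by (simp add: cutoff_one)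
  qed
  then show "0 \<le> chi x" "chi x \<le> 1" by auto
qed

lemma cutoff_smooth: "smooth chi"
  using chi unfolding low_freq_cutoff_def by blast

lemma cutoff_continuous: "continuous_on S chi"
  by (rule diff_order_continuous[OF smooth_diff_order[OF cutoff_smooth, of 0]])

lemma cutoff_diff_order: "diff_order n (\<lambda>x. complex_of_real (chi (l *\<^sub>R x)))"
proof (rule diff_order_of_real)
  show "diff_order n (\<lambda>x. chi (l *\<^sub>R x))"
    using diff_order_scale[OF smooth_diff_order[OF cutoff_smooth], of n 1 l] by simp
qed

lemma cutoff_mult_support:
  assumes "l > 0" "norm x > 2 / l"
  shows "complex_of_real (chi (l *\<^sub>R x)) * \<phi> x = 0"
proof -
  have "norm (l *\<^sub>R x) > 2"
    using assms by (simp add: pos_divide_less_eq mult.commute)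
  then show ?thesis by (simp add: cutoff_zero)
qed

text \<open>Positivity of \<open>l\<close> confines the support to a ball, where smoothness gives
  enough decay of the transform. Additivity of the pairing in the bounded function rests on
  this.\<close>

lemma fourier_test_integrable:
  assumes "\<phi> \<in> schwartz" "l > 0"
  shows "integrable lborel (fourier (\<lambda>\<xi>. complex_of_real (chi (l *\<^sub>R \<xi>)) * \<phi> \<xi>))"
proof (rule fourier_integrable)
  show "diff_order (DIM('a) + 2) (\<lambda>\<xi>. complex_of_real (chi (l *\<^sub>R \<xi>)) * \<phi> \<xi>)"
    by (rule diff_order_mult[OF cutoff_diff_order smooth_diff_order[OF schwartz_smooth[OF assms(1)]]])
  show "complex_of_real (chi (l *\<^sub>R \<xi>)) * \<phi> \<xi> = 0" if "norm \<xi> > 2 / l" for \<xi>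
    by (rule cutoff_mult_support[OF assms(2) that])
qed

lemma Sh_linf_subspace: "subspace (Sh_linf chi)"
proof (rule subspaceI)
  let ?T = "\<lambda>l \<phi>. fourier (\<lambda>\<xi>. complex_of_real (chi (l *\<^sub>R \<xi>)) * \<phi> \<xi>)"
  have "linf_distr 0 \<phi> = 0" for \<phi> :: "'a \<Rightarrow> complex"
    using linf_distr_scaleR[of 0 "0::'a linf" \<phi>] by simp
  then show "0 \<in> Sh_linf chi"
    unfolding Sh_linf_iff by simp
  show "c *\<^sub>R f \<in> Sh_linf chi" if "f \<in> Sh_linf chi" for c f
    using that unfolding Sh_linf_iff linf_distr_scaleR by (auto intro!: tendsto_mult_right_zero)
  show "f + g \<in> Sh_linf chi" if fg: "f \<in> Sh_linf chi" "g \<in> Sh_linf chi" for f g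
    unfolding Sh_linf_iff
  proof
    fix \<phi> :: "'a \<Rightarrow> complex" assume \<phi>: "\<phi> \<in> schwartz"
    have "((\<lambda>l. linf_distr f (?T l \<phi>) + linf_distr g (?T l \<phi>)) \<longlongrightarrow> 0) at_top"
      using fg \<phi> unfolding Sh_linf_iff by (auto intro: tendsto_add_zero)
    \<comment> \<open>Integrability of the test transforms is known for positive \<open>l\<close>,
      so additivity is claimed only eventually.\<close>
    moreover have "\<forall>\<^sub>F l in at_top. linf_distr f (?T l \<phi>) + linf_distr g (?T l \<phi>) =
        linf_distr (f + g) (?T l \<phi>)"
      using eventually_gt_at_top[of "0::real"]
      by eventually_elim (simp add: linf_distr_add fourier_test_integrable \<phi>)
    ultimately show "((\<lambda>l. linf_distr (f + g) (?T l \<phi>)) \<longlongrightarrow> 0) at_top"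
      by (rule Lim_transform_eventually)
  qed
qed

text \<open>Such an \<open>f\<close> is integrable, so the pairing is at most its L^1 norm times the
  supremum of the test transform, which is at most the L^1 norm \<open>s l\<close> of the cut-off
  \<open>\<phi>\<close>. The latter tends to zero as the support shrinks to the origin.\<close>

lemma bounded_support_in_Sh_linf:
  fixes f :: "'a \<Rightarrow> complex"
  assumes f: "ess_bounded f" "\<And>x. norm x > R \<Longrightarrow> f x = 0"
  shows "abs_linf f \<in> Sh_linf chi"
  unfolding Sh_linf_iff
proof
  fix \<phi> :: "'a \<Rightarrow> complex" assume \<phi>: "\<phi> \<in> schwartz"
  let ?T = "\<lambda>l. fourier (\<lambda>\<xi>. complex_of_real (chi (l *\<^sub>R \<xi>)) * \<phi> \<xi>)"
  define s where "s l = (LINT \<xi>|lborel. cmod (complex_of_real (chi (l *\<^sub>R \<xi>)) * \<phi> \<xi>))" for l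
  have fint: "integrable lborel f"
  proof (rule Bochner_Integration.integrable_bound)
    show "integrable lborel (\<lambda>x. norm (abs_linf f) * indicator (cball 0 R) x :: real)"
      by (intro integrable_mult_right integrable_real_indicator emeasure_bounded_finite) auto
    show "f \<in> borel_measurable lborel"
      using f by (simp add: ess_bounded_def)
    show "AE x in lborel. norm (f x) \<le> norm (norm (abs_linf f) * indicator (cball 0 R) x)"
      using ess_bounded_norm_AE[OF f(1)]
      by eventually_elim (use f(2) in \<open>auto simp: indicator_def\<close>)
  qed
  have [measurable]: "chi \<in> borel_measurable borel" "\<phi> \<in> borel_measurable borel"
    by (rule borel_measurable_continuous_onI[OF cutoff_continuous], rule schwartz_borel[OF \<phi>])
  have "(s \<longlongrightarrow> (LINT \<xi>|(lborel :: 'a measure). (0::real))) at_top"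
    unfolding s_def
  proof (rule integral_dominated_convergence_at_top[where f = "\<lambda>_. 0" and w = "\<lambda>\<xi>. cmod (\<phi> \<xi>)"])
    show "integrable lborel (\<lambda>\<xi>. cmod (\<phi> \<xi>))"
      using schwartz_integrable[OF \<phi>] by simp
    have "cmod (complex_of_real (chi (l *\<^sub>R \<xi>)) * \<phi> \<xi>) \<le> cmod (\<phi> \<xi>)" for l \<xi>
      using cutoff_range[of "l *\<^sub>R \<xi>"] by (simp add: norm_mult mult_left_le_one_le)
    then show "\<forall>\<^sub>F l in at_top. AE \<xi> in lborel.
        norm (cmod (complex_of_real (chi (l *\<^sub>R \<xi>)) * \<phi> \<xi>)) \<le> cmod (\<phi> \<xi>)"
      by simp
    \<comment> \<open>The origin is left out because \<open>chi\<close> is 1 there for every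
      \<open>l\<close>; elsewhere the integrand vanishes once \<open>l\<close> exceeds
      \<open>2 / norm \<xi>\<close>.\<close>
    show "AE \<xi> in lborel. ((\<lambda>l. cmod (complex_of_real (chi (l *\<^sub>R \<xi>)) * \<phi> \<xi>)) \<longlongrightarrow> 0) at_top"
      using AE_lborel_singleton[of "0::'a"]
    proof eventually_elim
      fix \<xi> :: 'a assume "\<xi> \<noteq> 0"
      have "\<forall>\<^sub>F l in at_top. cmod (complex_of_real (chi (l *\<^sub>R \<xi>)) * \<phi> \<xi>) = 0"
        using eventually_gt_at_top[of 0] eventually_gt_at_top[of "2 / norm \<xi>"]
        by eventually_elim (use \<open>\<xi> \<noteq> 0\<close> in \<open>simp add: cutoff_zero field_simps\<close>)
      then show "((\<lambda>l. cmod (complex_of_real (chi (l *\<^sub>R \<xi>)) * \<phi> \<xi>)) \<longlongrightarrow> 0) at_top"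
        by (rule tendsto_eventually)
    qed
  qed measurable
  then have "((\<lambda>l. s l * (LINT x|lborel. cmod (f x))) \<longlongrightarrow> 0) at_top"
    by (intro tendsto_mult_left_zero) simp
  then show "((\<lambda>l. linf_distr (abs_linf f) (?T l)) \<longlongrightarrow> 0) at_top"
  proof (rule Lim_null_comparison[rotated])
    show "\<forall>\<^sub>F l in at_top. cmod (linf_distr (abs_linf f) (?T l)) \<le> s l * (LINT x|lborel. cmod (f x))"
      using eventually_gt_at_top[of "0::real"]
    proof eventually_elim
      fix l :: real assume l: "l > 0"
      note T = fourier_test_integrable[OF \<phi> l]
      have "cmod (linf_distr (abs_linf f) (?T l)) = cmod (LINT x|lborel. f x * ?T l x)"
        using T f by (simp add: linf_distr_abs)
      also have "\<dots> \<le> (LINT x|lborel. cmod (f x * ?T l x))"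
        by (rule integral_norm_bound)
      also have "\<dots> \<le> (LINT x|lborel. s l * cmod (f x))"
      proof (rule integral_mono)
        show "integrable lborel (\<lambda>x. cmod (f x * ?T l x))"
          by (intro integrable_norm ess_bounded_mult_integrable f T)
        show "integrable lborel (\<lambda>x. s l * cmod (f x))"
          using fint by simp
        show "cmod (f x * ?T l x) \<le> s l * cmod (f x)" for x
          using mult_right_mono[OF cmod_fourier_le, of "cmod (f x)" "\<lambda>\<xi>. complex_of_real (chi (l *\<^sub>R \<xi>)) * \<phi> \<xi>" x]
          by (simp add: s_def norm_mult mult.commute)
      qed
      finally show "cmod (linf_distr (abs_linf f) (?T l)) \<le> s l * (LINT x|lborel. cmod (f x))"
        by simp
    qed
  qed
qed

lemma cutoff_iter_partial:
  assumes "bs \<in> lists Basis"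
  shows "iter_partial bs (\<lambda>x. complex_of_real (chi x)) = (\<lambda>x. complex_of_real (iter_partial bs chi x)) \<and>
    (\<forall>x. norm x > 2 \<longrightarrow> iter_partial bs chi x = 0)"
  using assms
proof (induction bs)
  case Nil
  then show ?case by (simp add: iter_partial_def cutoff_zero)
next
  case (Cons b bs)
  have step: "iter_partial (b # bs) f = (\<lambda>x. frechet_derivative (iter_partial bs f) (at x) b)"
    for f :: "'a \<Rightarrow> 'c::real_normed_vector"
    by (simp add: iter_partial_def)
  have "\<forall>x. iter_partial bs chi differentiable (at x)"
    using cutoff_smooth Cons.hyps unfolding smooth_def by blast
  then have "((\<lambda>x. complex_of_real (iter_partial bs chi x)) has_derivative
      (\<lambda>h. complex_of_real (frechet_derivative (iter_partial bs chi) (at x) h))) (at x)" for x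
    by (intro has_derivative_of_real) (simp add: frechet_derivative_works)
  then have "frechet_derivative (\<lambda>x. complex_of_real (iter_partial bs chi x)) (at x) =
      (\<lambda>h. complex_of_real (frechet_derivative (iter_partial bs chi) (at x) h))" for x
    by (rule frechet_derivative_at[symmetric])
  moreover have "frechet_derivative (iter_partial bs chi) (at x) b = 0" if "norm x > 2" for x
    using Cons.IH that by (intro frechet_derivative_zero_outside[of 2]) auto
  ultimately show ?case
    unfolding step Cons.IH[THEN conjunct1] by simp
qed

text \<open>Makes the cutoff itself available as the test function that detects shells. Its
  derivatives are continuous with bounded support, so every weighted supremum is finite.\<close>

lemma cutoff_schwartz: "(\<lambda>x. complex_of_real (chi x)) \<in> schwartz"
proof -
  let ?f = "\<lambda>x. complex_of_real (chi x)"
  have diff: "iter_partial bs ?f differentiable (at x)" if "bs \<in> lists Basis" for bs x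
  proof -
    have "iter_partial bs chi differentiable (at x)"
      using cutoff_smooth that unfolding smooth_def by blast
    then show ?thesis
      unfolding cutoff_iter_partial[OF that, THEN conjunct1] differentiable_def by (auto intro: has_derivative_of_real)
  qed
  have "bdd_above (range (\<lambda>x. (1 + norm x) ^ k * cmod (iter_partial bs ?f x)))" if bs: "bs \<in> lists Basis" for k bs
  proof -
    have "continuous_on UNIV (\<lambda>x. complex_of_real ((1 + norm x) ^ k) * iter_partial bs ?f x)"
      using diff[OF bs]
      by (intro continuous_intros) (meson differentiable_imp_continuous_within continuous_at_imp_continuous_on)
    then obtain M where "M \<ge> 0" and M: "\<And>x. cmod (complex_of_real ((1 + norm x) ^ k) * iter_partial bs ?f x) \<le> M"
      by (rule bounded_compact_support[where R = 2])
        (simp_all add: cutoff_iter_partial[OF bs])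
    have "(1 + norm x) ^ k * cmod (iter_partial bs ?f x) \<le> M" for x
    proof -
      have "\<bar>(1 + norm x) ^ k\<bar> = (1 + norm x) ^ k" by simp
      then show ?thesis using M[of x] by (simp only: norm_mult norm_of_real)
    qed
    then show ?thesis by (intro bdd_aboveI[of _ M]) blast
  qed
  then show ?thesis
    using diff by (auto simp: schwartz_def smooth_def)
qed

end

text \<open>A closed set of full Lebesgue measure is the whole space.\<close>

lemma AE_zero_continuous:
  fixes g :: "'a::euclidean_space \<Rightarrow> 'b::real_normed_vector"
  assumes "AE x in lborel. g x = 0" "continuous_on UNIV g"
  shows "g x = 0"
proof -
  have "closed {x. g x = 0}"
    using assms(2) by (intro closed_Collect_eq) auto
  moreover have "AE x in lebesgue. x \<in> {x. g x = 0}"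
    using AE_completion[OF assms(1)] by simp
  ultimately show ?thesis
    using mem_closed_if_AE_lebesgue by blast
qed

subsection \<open>Almost disjoint families and shells\<close>

text \<open>Codes of the finite initial segments of a 0-1 sequence, that is, a path in the binary
  tree. These paths form the uncountable almost disjoint family.\<close>

definition branch :: "(nat \<Rightarrow> bool) \<Rightarrow> nat set" where
  "branch s = range (\<lambda>n. to_nat (map s [0..<n]))"

lemma infinite_branch: "infinite (branch s)"
proof -
  have "inj (\<lambda>n. to_nat (map s [0..<n]))"
  proof (rule injI)
    fix m n assume "to_nat (map s [0..<m]) = to_nat (map s [0..<n])"
    then have "length (map s [0..<m]) = length (map s [0..<n])" by simp
    then show "m = n" by simp
  qed
  then show ?thesis unfolding branch_def by (rule range_inj_infinite)
qed

lemma finite_branch_Int: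
  assumes "s \<noteq> t"
  shows "finite (branch s \<inter> branch t)"
proof -
  obtain k where k: "s k \<noteq> t k" using assms by auto
  \<comment> \<open>A code determines the length of its segment, and no segment longer than
    \<open>k\<close> is shared, since the sequences differ at \<open>k\<close>.\<close>
  have "branch s \<inter> branch t \<subseteq> (\<lambda>n. to_nat (map s [0..<n])) ` {..k}"
  proof
    fix x assume "x \<in> branch s \<inter> branch t"
    then have "x \<in> branch s" "x \<in> branch t" by auto
    then obtain m n where x: "x = to_nat (map s [0..<m])" and x': "x = to_nat (map t [0..<n])"
      unfolding branch_def image_iff by blast
    then have eq: "map s [0..<m] = map t [0..<n]" by simp
    have "length (map s [0..<m]) = length (map t [0..<n])" by (simp only: eq)
    then have "m = n" by simp
    with eq have "\<forall>i<m. s i = t i" by simp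
    then have "m \<le> k" using k not_le by blast
    with x show "x \<in> (\<lambda>n. to_nat (map s [0..<n])) ` {..k}" by blast
  qed
  then show ?thesis by (rule finite_subset) simp
qed

lemma uncountable_branches: "uncountable (UNIV :: (nat \<Rightarrow> bool) set)"
proof
  assume "countable (UNIV :: (nat \<Rightarrow> bool) set)"
  then obtain f :: "nat \<Rightarrow> nat \<Rightarrow> bool" where f: "range f = UNIV"
    using uncountable_def by blast
  then obtain n where "f n = (\<lambda>k. \<not> f k k)" by (metis UNIV_I imageE)
  then show False by (metis (full_types))
qed

text \<open>Sums with unimodular coefficients over almost disjoint index sets are bounded by one off a
  bounded set, which bounds how many of the values can exceed a given threshold.\<close>

lemma countable_nonvanishing:
  fixes L :: "'a::euclidean_space linf \<Rightarrow> real" and h :: "'a \<Rightarrow> complex" and idx :: "'a \<Rightarrow> nat"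
  assumes L: "bounded_linear L"
    and L0: "\<And>f R. ess_bounded f \<Longrightarrow> (\<And>x. norm x > R \<Longrightarrow> f x = 0) \<Longrightarrow> L (abs_linf f) = 0"
    and h [measurable]: "h \<in> borel_measurable borel" and h1: "\<And>x. cmod (h x) \<le> 1"
    and idx [measurable]: "idx \<in> borel \<rightarrow>\<^sub>M count_space UNIV"
    and bdd: "\<And>N. \<exists>R. \<forall>x. idx x \<le> N \<longrightarrow> norm x \<le> R"
  shows "countable {s. L (abs_linf (\<lambda>x. if idx x \<in> branch s then h x else 0)) \<noteq> 0}"
proof -
  interpret L: bounded_linear L by (rule L)
  let ?F = "\<lambda>s x. if idx x \<in> branch s then h x else 0"
  have Fb: "ess_bounded (?F s)" for s
    by (rule ess_boundedI[of _ 1]) (auto simp: h1)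
  obtain K where K: "\<And>f. \<bar>L f\<bar> \<le> norm f * K" "K > 0"
    using L.pos_bounded by auto
  have fin: "finite {s. \<bar>L (abs_linf (?F s))\<bar> > 1 / real (Suc k)}" for k
  proof (rule ccontr)
    assume "infinite {s. \<bar>L (abs_linf (?F s))\<bar> > 1 / real (Suc k)}"
    \<comment> \<open>The size is one more than \<open>K * real (Suc k)\<close> rounded up, so that
      the threshold summed over \<open>S\<close> exceeds the operator bound
      \<open>K\<close>.\<close>
    then obtain S where S: "S \<subseteq> {s. \<bar>L (abs_linf (?F s))\<bar> > 1 / real (Suc k)}" "finite S"
      "card S = nat \<lceil>K * real (Suc k)\<rceil> + 1"
      using infinite_arbitrarily_large by blast
    \<comment> \<open>These signs turn each value of \<open>L\<close> into its absolute value, so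
      nothing cancels in the sum.\<close>
    define \<sigma> where "\<sigma> s = sgn (L (abs_linf (?F s)))" for s
    define g where "g x = (\<Sum>s\<in>S. of_real (\<sigma> s) * ?F s x)" for x
    have g: "ess_bounded g" "abs_linf g = (\<Sum>s\<in>S. \<sigma> s *\<^sub>R abs_linf (?F s))"
      using abs_linf_sum[OF S(2), of ?F \<sigma>] Fb by (auto simp: g_def[abs_def])
    have [measurable]: "g \<in> borel_measurable borel"
      using g(1) by (simp add: ess_bounded_def)
    \<comment> \<open>Indices of shells shared by two members of \<open>S\<close>: finitely many, so
      these shells lie in a bounded region.\<close>
    define I where "I = (\<Union>(s, t)\<in>{p\<in>S \<times> S. fst p \<noteq> snd p}. branch s \<inter> branch t)"
    have "finite I"
      unfolding I_def using S(2) by (auto intro!: finite_UN_I finite_branch_Int)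
    then obtain N where N: "\<And>n. n \<in> I \<Longrightarrow> n \<le> N"
      using finite_nat_set_iff_bounded_le by auto
    obtain R where R: "\<And>x. idx x \<le> N \<Longrightarrow> norm x \<le> R" using bdd by blast
    \<comment> \<open>Off the shared shells at most one summand survives, so \<open>u\<close> is
      bounded by 1; the remainder \<open>v\<close> has bounded support and is annihilated by
      \<open>L\<close>.\<close>
    define u where "u x = (if idx x \<in> I then 0 else g x)" for x
    define v where "v x = (if idx x \<in> I then g x else 0)" for x
    have um: "u \<in> borel_measurable borel" and vm: "v \<in> borel_measurable borel"
      unfolding u_def v_def by measurable
    have \<sigma>1: "\<bar>\<sigma> s\<bar> \<le> 1" for s by (simp add: \<sigma>_def sgn_if)
    have u1: "cmod (u x) \<le> 1" for x
    proof (cases "idx x \<in> I \<or> (\<forall>s\<in>S. idx x \<notin> branch s)")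
      case True
      then show ?thesis by (auto simp: u_def g_def)
    next
      case False
      then obtain s where s: "s \<in> S" "idx x \<in> branch s" and nI: "idx x \<notin> I" by auto
      have "idx x \<notin> branch t" if "t \<in> S" "t \<noteq> s" for t
        using nI s that unfolding I_def by force
      then have "(\<Sum>t\<in>S - {s}. of_real (\<sigma> t) * ?F t x) = 0"
        by (intro sum.neutral) auto
      then have "g x = of_real (\<sigma> s) * h x"
        unfolding g_def using s S(2) by (subst sum.remove[of S s]) auto
      then show ?thesis
        using nI \<sigma>1[of s] h1[of x] by (simp add: u_def norm_mult mult_le_one)
    qed
    have ub: "ess_bounded u"
      using um u1 by (intro ess_boundedI[of _ 1]) auto
    obtain c where "AE x in lborel. cmod (g x) \<le> c" using g(1) by (auto simp: ess_bounded_iff)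
    then have "AE x in lborel. cmod (v x) \<le> \<bar>c\<bar>"
      by eventually_elim (auto simp: v_def)
    then have vb: "ess_bounded v" using vm by (intro ess_boundedI) auto
    have "L (abs_linf v) = 0"
    proof (rule L0[OF vb])
      fix x :: 'a assume "norm x > R"
      then have "idx x \<notin> I" using R N by (meson not_le)
      then show "v x = 0" by (simp add: v_def)
    qed
    moreover have "abs_linf g = abs_linf u + abs_linf v"
      using ub vb by (simp add: plus_linf.abs_eq linf_rel_refl) (simp add: u_def v_def if_distrib cong: if_cong)
    ultimately have "L (abs_linf g) = L (abs_linf u)" by (simp add: L.add)
    also have "\<dots> \<le> norm (abs_linf u) * K" using K(1)[of "abs_linf u"] by linarith
    also have "\<dots> \<le> 1 * K"
      using u1 K(2) by (intro mult_right_mono norm_abs_linf_le[OF ub]) auto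
    finally have up: "L (abs_linf g) \<le> K" by simp
    have "real (card S) * (1 / real (Suc k)) = (\<Sum>s\<in>S. 1 / real (Suc k))" by simp
    also have "\<dots> \<le> (\<Sum>s\<in>S. \<sigma> s * L (abs_linf (?F s)))"
      using S(1) by (intro sum_mono) (force simp: \<sigma>_def sgn_if)
    also have "\<dots> = L (abs_linf g)"
      unfolding g(2) by (simp add: L.sum L.scaleR)
    finally have "real (card S) / real (Suc k) \<le> K"
      using up by simp
    then have "real (card S) \<le> K * real (Suc k)"
      by (simp only: pos_divide_le_eq of_nat_0_less_iff zero_less_Suc)
    moreover have "real (card S) > K * real (Suc k)"
      unfolding S(3) by linarith
    ultimately show False by simp
  qed
  have "{s. L (abs_linf (?F s)) \<noteq> 0} \<subseteq> (\<Union>k. {s. \<bar>L (abs_linf (?F s))\<bar> > 1 / real (Suc k)})"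
  proof
    fix s assume "s \<in> {s. L (abs_linf (?F s)) \<noteq> 0}"
    then have "\<bar>L (abs_linf (?F s))\<bar> > 0" by simp
    then obtain k where "inverse (real (Suc k)) < \<bar>L (abs_linf (?F s))\<bar>"
      using reals_Archimedean by blast
    then show "s \<in> (\<Union>k. {s. \<bar>L (abs_linf (?F s))\<bar> > 1 / real (Suc k)})"
      by (auto simp: inverse_eq_divide)
  qed
  then show ?thesis
    by (rule countable_subset[OF _ countable_UN[OF countableI_type countable_finite[OF fin]]])
qed

text \<open>Shell \<open>n\<close> is where \<open>1 + norm x\<close> lies between exp(n^2),
  included, and exp((n+1)^2), excluded.\<close>

definition shell_index :: "'a::euclidean_space \<Rightarrow> nat" where
  "shell_index x = nat \<lfloor>sqrt (ln (1 + norm x))\<rfloor>"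

text \<open>Lies a factor exp(n) above exp(n^2) and a factor exp(n+1) below exp((n+1)^2); both
  factors tend to infinity.\<close>

definition shell_scale :: "nat \<Rightarrow> real" where
  "shell_scale n = exp (real n ^ 2 + real n)"

lemma shell_scale_pos: "shell_scale n > 0"
  by (simp add: shell_scale_def)

lemma shell_index_measurable [measurable]: "shell_index \<in> borel \<rightarrow>\<^sub>M count_space UNIV"
  unfolding shell_index_def by measurable

lemma shell_index_bounded: "\<exists>R. \<forall>x::'a::euclidean_space. shell_index x \<le> N \<longrightarrow> norm x \<le> R"
proof (intro exI[of _ "exp ((real N + 1) ^ 2)"] allI impI)
  fix x :: 'a assume "shell_index x \<le> N"
  then have "sqrt (ln (1 + norm x)) < real N + 1"
    unfolding shell_index_def by linarith
  then have "ln (1 + norm x) < (real N + 1) ^ 2"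
    using real_less_rsqrt real_sqrt_less_iff by (metis add_nonneg_nonneg of_nat_0_le_iff real_sqrt_abs abs_of_nonneg zero_le_one)
  then have "exp (ln (1 + norm x)) < exp ((real N + 1) ^ 2)" by simp
  then show "norm x \<le> exp ((real N + 1) ^ 2)"
    by (simp add: add_pos_nonneg)
qed

text \<open>Scaled down by \<open>shell_scale n\<close>, the shell \<open>n\<close> has inner radius
  at most exp(-n) and outer radius of order exp(n+1), so the scaled shells reach every nonzero
  point.\<close>

lemma eventually_shell_index:
  fixes y :: "'a::euclidean_space"
  assumes "y \<noteq> 0"
  shows "\<forall>\<^sub>F n in sequentially. shell_index (shell_scale n *\<^sub>R y) = n"
proof -
  let ?c = "norm y"
  have c: "?c > 0" using assms by simp
  show ?thesis
    \<comment> \<open>The threshold makes exp(n) at least \<open>1 / ?c\<close>, for the inner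
      radius, and at least \<open>1 + ?c\<close>, for the outer one.\<close>
    using eventually_ge_at_top[of "nat \<lceil>?c + 1 / ?c\<rceil>"]
  proof eventually_elim
    fix n assume "nat \<lceil>?c + 1 / ?c\<rceil> \<le> n"
    then have n: "?c + 1 / ?c \<le> real n" by linarith
    have "1 + real n \<le> exp (real n)" by (rule exp_ge_add_one_self)
    with n c have e: "1 / ?c \<le> exp (real n)" "1 + ?c \<le> exp (real n)"
      by (smt (verit) divide_pos_pos)+
    have norm: "norm (shell_scale n *\<^sub>R y) = exp (real n ^ 2) * exp (real n) * ?c"
      by (simp add: shell_scale_def exp_add)
    have pos: "1 + norm (shell_scale n *\<^sub>R y) > 0" by (simp add: add_pos_nonneg)
    have "exp (real n ^ 2) * 1 \<le> exp (real n ^ 2) * (exp (real n) * ?c)"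
      using e(1) c by (intro mult_left_mono) (auto simp: field_simps)
    then have "exp (real n ^ 2) \<le> norm (shell_scale n *\<^sub>R y)"
      by (simp only: norm mult.assoc mult_1_right)
    then have "exp (real n ^ 2) \<le> 1 + norm (shell_scale n *\<^sub>R y)" by linarith
    then have lo: "real n ^ 2 \<le> ln (1 + norm (shell_scale n *\<^sub>R y))"
      using pos by (simp add: ln_ge_iff)
    have "1 + norm (shell_scale n *\<^sub>R y) \<le> exp (real n ^ 2) * exp (real n) * (1 + ?c)"
    proof -
      have "1 * 1 \<le> exp (real n ^ 2) * exp (real n)" by (intro mult_mono) auto
      then show ?thesis unfolding norm by (simp add: distrib_left)
    qed
    also have "\<dots> \<le> exp (real n ^ 2) * exp (real n) * exp (real n)"
      using e(2) by (intro mult_left_mono) auto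
    also have "\<dots> < exp ((real n + 1) ^ 2)"
      by (simp add: exp_add[symmetric] power2_eq_square algebra_simps)
    finally have "ln (1 + norm (shell_scale n *\<^sub>R y)) < ln (exp ((real n + 1) ^ 2))"
      using pos by (subst ln_less_cancel_iff) auto
    then have hi: "ln (1 + norm (shell_scale n *\<^sub>R y)) < (real n + 1) ^ 2" by simp
    have "real n \<le> sqrt (ln (1 + norm (shell_scale n *\<^sub>R y)))"
      using lo by (rule real_le_rsqrt)
    moreover have "sqrt (ln (1 + norm (shell_scale n *\<^sub>R y))) < real n + 1"
      using hi by (intro real_less_lsqrt) auto
    ultimately show "shell_index (shell_scale n *\<^sub>R y) = n"
      unfolding shell_index_def by linarith
  qed
qed

subsection \<open>Shell functions and the cutoff\<close>

context
  fixes chi :: "'a::euclidean_space \<Rightarrow> real"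
  assumes chi: "low_freq_cutoff chi"
begin

definition cutoff_kernel :: "'a \<Rightarrow> complex" where
  "cutoff_kernel = fourier (\<lambda>\<xi>. complex_of_real (chi \<xi>))"

text \<open>Against the kernel rescaled by \<^term>\<open>shell_scale n\<close>, this phase integrates to the $L^1$ norm
  of the kernel over the \<open>n\<close>-th shell.\<close>

definition phase :: "'a \<Rightarrow> complex" where
  "phase x = cnj (sgn (cutoff_kernel (x /\<^sub>R shell_scale (shell_index x))))"

lemma cutoff_kernel_continuous: "continuous_on S cutoff_kernel"
  unfolding cutoff_kernel_def by (intro fourier_continuous schwartz_integrable cutoff_schwartz chi)

lemma cutoff_kernel_measurable [measurable]: "cutoff_kernel \<in> borel_measurable borel"
  by (intro borel_measurable_continuous_onI cutoff_kernel_continuous)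

lemma cutoff_kernel_integrable: "integrable lborel cutoff_kernel"
  unfolding cutoff_kernel_def
  using fourier_integrable[OF cutoff_diff_order[OF chi, of _ 1], of 2] cutoff_zero[OF chi] by simp

text \<open>The value at the origin is the integral of \<open>chi\<close>, which is nonnegative,
  continuous and equal to 1 at 0.\<close>

lemma cutoff_kernel_zero: "cutoff_kernel 0 \<noteq> 0"
proof
  assume "cutoff_kernel 0 = 0"
  then have "complex_of_real (LINT \<xi>|lborel. chi \<xi>) = 0"
    by (simp add: cutoff_kernel_def fourier_def)
  then have "(LINT \<xi>|lborel. chi \<xi>) = 0" by (simp only: of_real_eq_0_iff)
  moreover have "integrable lborel (\<lambda>\<xi>. Re (complex_of_real (chi \<xi>)))"
    by (intro integrable_Re schwartz_integrable cutoff_schwartz chi)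
  ultimately have "AE \<xi> in lborel. chi \<xi> = 0"
    using cutoff_range[OF chi] by (subst (asm) integral_nonneg_eq_0_iff_AE) auto
  then have "chi 0 = 0"
    by (rule AE_zero_continuous[OF _ cutoff_continuous[OF chi]])
  then show False using cutoff_one[OF chi, of 0] by simp
qed

lemma cutoff_kernel_norm_pos: "(LINT x|lborel. cmod (cutoff_kernel x)) > 0"
proof (rule ccontr)
  assume "\<not> ?thesis"
  moreover have "(LINT x|lborel. cmod (cutoff_kernel x)) \<ge> 0" by simp
  ultimately have "(LINT x|lborel. cmod (cutoff_kernel x)) = 0" by linarith
  then have "AE x in lborel. cmod (cutoff_kernel x) = 0"
    using cutoff_kernel_integrable by (subst (asm) integral_nonneg_eq_0_iff_AE) auto
  then have "AE x in lborel. cutoff_kernel x = 0" by simp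
  then have "cutoff_kernel 0 = 0" by (rule AE_zero_continuous[OF _ cutoff_kernel_continuous])
  with cutoff_kernel_zero show False by simp
qed

lemma phase_measurable [measurable]: "phase \<in> borel_measurable borel"
proof -
  have [measurable]: "(\<lambda>x::'a. shell_scale (shell_index x)) \<in> borel_measurable borel"
    by (rule measurable_compose[OF shell_index_measurable]) simp
  have "cnj \<in> borel_measurable borel" by (intro borel_measurable_continuous_onI continuous_intros)
  moreover have "(\<lambda>x. sgn (cutoff_kernel (x /\<^sub>R shell_scale (shell_index x)))) \<in> borel_measurable borel"
    unfolding sgn_div_norm by measurable
  ultimately show ?thesis
    unfolding phase_def by (rule measurable_compose[rotated])
qed

lemma cmod_phase_le: "cmod (phase x) \<le> 1"
  by (simp add: phase_def norm_sgn)

abbreviation shells :: "nat set \<Rightarrow> 'a \<Rightarrow> complex" where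
  "shells A \<equiv> \<lambda>x. if shell_index x \<in> A then phase x else 0"

lemma shells_bounded: "ess_bounded (shells A)"
  by (rule ess_boundedI[of _ 1]) (auto simp: cmod_phase_le)

text \<open>For \<open>l\<close> at least 2 the dilated cutoff lives in the unit ball, where
  \<open>chi\<close> is 1, so testing against \<open>chi\<close> returns the dilated cutoff. Its
  transform is a rescaled kernel, and the substitution of \<open>l *\<^sub>R y\<close> for
  \<open>x\<close> moves the dilation onto the shell function.\<close>

lemma linf_distr_shells:
  assumes "l \<ge> 2"
  shows "linf_distr (abs_linf (shells A))
      (fourier (\<lambda>\<xi>. complex_of_real (chi (l *\<^sub>R \<xi>)) * complex_of_real (chi \<xi>))) =
    (LINT y|lborel. shells A (l *\<^sub>R y) * cutoff_kernel y)"
proof -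
  have "(\<lambda>\<xi>. complex_of_real (chi (l *\<^sub>R \<xi>)) * complex_of_real (chi \<xi>)) =
      (\<lambda>\<xi>. complex_of_real (chi (l *\<^sub>R \<xi>)))"
  proof
    fix \<xi>
    show "complex_of_real (chi (l *\<^sub>R \<xi>)) * complex_of_real (chi \<xi>) = complex_of_real (chi (l *\<^sub>R \<xi>))"
    proof (cases "norm \<xi> \<le> 1")
      case True
      then show ?thesis by (simp add: cutoff_one[OF chi])
    next
      case False
      then have "2 * 1 < l * norm \<xi>" using assms by (intro mult_le_less_imp_less) auto
      then have "norm (l *\<^sub>R \<xi>) > 2" using assms by simp
      then show ?thesis by (simp add: cutoff_zero[OF chi])
    qed
  qed
  moreover have "fourier (\<lambda>\<xi>. complex_of_real (chi (l *\<^sub>R \<xi>))) = (\<lambda>x. cutoff_kernel (x /\<^sub>R l) / of_real (l ^ DIM('a)))"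
    using fourier_scale[OF schwartz_borel[OF cutoff_schwartz[OF chi]], of l] assms
    by (auto simp: cutoff_kernel_def)
  ultimately have "linf_distr (abs_linf (shells A))
      (fourier (\<lambda>\<xi>. complex_of_real (chi (l *\<^sub>R \<xi>)) * complex_of_real (chi \<xi>))) =
      (LINT x|lborel. shells A x * (cutoff_kernel (x /\<^sub>R l) / of_real (l ^ DIM('a))))"
    using linf_distr_abs[OF shells_bounded, of "\<lambda>x. cutoff_kernel (x /\<^sub>R l) / of_real (l ^ DIM('a))" A] by simp
  also have "\<dots> = of_real (l ^ DIM('a)) *
      (LINT y|lborel. shells A (l *\<^sub>R y) * (cutoff_kernel ((l *\<^sub>R y) /\<^sub>R l) / of_real (l ^ DIM('a))))"
    using assms by (intro lborel_integral_scale) auto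
  also have "\<dots> = of_real (l ^ DIM('a)) *
      (LINT y|lborel. (shells A (l *\<^sub>R y) * cutoff_kernel y) / of_real (l ^ DIM('a)))"
    using assms by simp
  also have "\<dots> = (LINT y|lborel. shells A (l *\<^sub>R y) * cutoff_kernel y)"
    using assms by (subst integral_divide_zero) simp
  finally show ?thesis .
qed

text \<open>Along the scales of the shells in an infinite \<open>A\<close> the pairing tends to the
  positive L^1 norm of the kernel instead of zero.\<close>

lemma shells_in_Sh_linf_finite:
  assumes "abs_linf (shells A) \<in> Sh_linf chi"
  shows "finite A"
proof (rule ccontr)
  assume inf: "infinite A"
  define l where "l k = shell_scale (enumerate A k)" for k
  have en: "filterlim (enumerate A) at_top sequentially"
    by (rule filterlim_subseq[OF strict_mono_enumerate[OF inf]])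
  have "real n \<le> shell_scale n" for n
    using exp_ge_add_one_self[of "real n ^ 2 + real n"] zero_le_power2[of "real n"]
    unfolding shell_scale_def by linarith
  then have "filterlim shell_scale at_top sequentially"
    by (intro filterlim_at_top_mono[OF filterlim_real_sequentially] always_eventually) simp
  then have l: "filterlim l at_top sequentially"
    unfolding l_def using en by (rule filterlim_compose)
  let ?I = "\<lambda>k. LINT y|lborel. shells A (l k *\<^sub>R y) * cutoff_kernel y"
  have "?I \<longlonglongrightarrow> 0"
  proof (rule Lim_transform_eventually)
    show "(\<lambda>k. linf_distr (abs_linf (shells A)) (fourier (\<lambda>\<xi>. complex_of_real (chi (l k *\<^sub>R \<xi>)) *
        complex_of_real (chi \<xi>)))) \<longlonglongrightarrow> 0"
      using bspec[OF assms[unfolded Sh_linf_iff] cutoff_schwartz[OF chi]]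
      by (rule filterlim_compose[OF _ l])
    show "\<forall>\<^sub>F k in sequentially. linf_distr (abs_linf (shells A))
        (fourier (\<lambda>\<xi>. complex_of_real (chi (l k *\<^sub>R \<xi>)) * complex_of_real (chi \<xi>))) = ?I k"
      using eventually_compose_filterlim[OF eventually_ge_at_top[of 2] l]
      by eventually_elim (rule linf_distr_shells)
  qed
  moreover have "?I \<longlonglongrightarrow> (LINT y|lborel. complex_of_real (cmod (cutoff_kernel y)))"
  proof (rule integral_dominated_convergence[where w = "\<lambda>y. cmod (cutoff_kernel y)"])
    show "integrable lborel (\<lambda>y. cmod (cutoff_kernel y))"
      using cutoff_kernel_integrable by simp
    show "AE y in lborel. norm (shells A (l k *\<^sub>R y) * cutoff_kernel y) \<le> cmod (cutoff_kernel y)" for k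
      by (auto simp: norm_mult intro!: AE_I2 mult_left_le_one_le cmod_phase_le)
    show "AE y in lborel. (\<lambda>k. shells A (l k *\<^sub>R y) * cutoff_kernel y) \<longlonglongrightarrow> complex_of_real (cmod (cutoff_kernel y))"
      using AE_lborel_singleton[of "0::'a"]
    proof eventually_elim
      fix y :: 'a assume y: "y \<noteq> 0"
      \<comment> \<open>For large \<open>k\<close> the dilated point lies in the shell whose scale
        is \<open>l k\<close>, so the phase is that of the kernel at \<open>y\<close> itself and
        cancels its argument.\<close>
      have "\<forall>\<^sub>F k in sequentially. shells A (l k *\<^sub>R y) * cutoff_kernel y = complex_of_real (cmod (cutoff_kernel y))"
        using eventually_compose_filterlim[OF eventually_shell_index[OF y] en]
      proof eventually_elim
        fix k assume k: "shell_index (shell_scale (enumerate A k) *\<^sub>R y) = enumerate A k"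
        have "cnj (sgn z) * z = complex_of_real (cmod z)" for z
        proof (cases "z = 0")
          case False
          have "cnj z * z = complex_of_real (cmod z) * complex_of_real (cmod z)"
            using complex_norm_square[of z] by (simp add: power2_eq_square mult.commute)
          then show ?thesis
            using False by (simp add: sgn_div_norm scaleR_conv_of_real field_simps)
        qed simp
        moreover have "shells A (l k *\<^sub>R y) = cnj (sgn (cutoff_kernel y))"
          using k enumerate_in_set[OF inf, of k] shell_scale_pos[of "enumerate A k"]
          by (simp add: l_def phase_def)
        ultimately show "shells A (l k *\<^sub>R y) * cutoff_kernel y = complex_of_real (cmod (cutoff_kernel y))"
          by simp
      qed
      then show "(\<lambda>k. shells A (l k *\<^sub>R y) * cutoff_kernel y) \<longlonglongrightarrow> complex_of_real (cmod (cutoff_kernel y))"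
        by (rule tendsto_eventually)
    qed
  qed measurable
  ultimately have "(LINT y|lborel. complex_of_real (cmod (cutoff_kernel y))) = 0"
    by (rule LIMSEQ_unique[rotated])
  then show False using cutoff_kernel_norm_pos by simp
qed

end

section \<open>Projection along a direct sum, and the conclusion\<close>

lemma subspace_linf: "linf.subspace G \<Longrightarrow> subspace G"
  by (auto simp: subspace_def linf.subspace_def scaleR_linf_def)

text \<open>Uniqueness of components makes the given map \<open>Q\<close> linear, and continuity at
  0 then makes it bounded.\<close>

lemma topological_direct_sum_projection:
  fixes X G :: "'b::real_normed_vector set"
  assumes "topological_direct_sum X G" "subspace X" "subspace G"
  shows "\<exists>Q :: 'b \<Rightarrow> 'b. bounded_linear Q \<and> (\<forall>f. Q f = 0 \<longleftrightarrow> f \<in> X)"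
proof -
  obtain P Q :: "'b \<Rightarrow> 'b" where XG: "X \<inter> G = {0}" and PQ: "\<And>f. P f \<in> X" "\<And>f. Q f \<in> G" "\<And>f. f = P f + Q f"
    and Q: "continuous_on UNIV Q"
    using assms(1) unfolding topological_direct_sum_def by blast
  \<comment> \<open>Two decompositions of \<open>f\<close> differ by an element of the intersection,
    which is zero.\<close>
  have uniq: "Q f = g" if "g \<in> G" "f - g \<in> X" for f g
  proof -
    have "f - P f = Q f" using PQ(3)[of f] by (metis add_diff_cancel_left')
    then have "Q f - g = (f - g) - P f" by (simp add: algebra_simps)
    moreover have "Q f - g \<in> G" "(f - g) - P f \<in> X"
      using assms(2,3) that PQ(1,2) by (auto intro: subspace_diff)
    ultimately have "Q f - g \<in> X \<inter> G" by (metis IntI)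
    then show ?thesis using XG by simp
  qed
  have diffX: "f - Q f \<in> X" for f
    using PQ(1)[of f] PQ(3)[of f] by (metis add_diff_cancel_right')
  have lin: "linear Q"
  proof (rule linearI)
    fix f g
    have "f + g - (Q f + Q g) = (f - Q f) + (g - Q g)" by simp
    also have "\<dots> \<in> X" by (rule subspace_add[OF assms(2) diffX diffX])
    finally show "Q (f + g) = Q f + Q g"
      by (rule uniq[OF subspace_add[OF assms(3) PQ(2) PQ(2)]])
  next
    fix r f
    have "r *\<^sub>R f - r *\<^sub>R Q f = r *\<^sub>R (f - Q f)" by (simp add: scaleR_diff_right)
    also have "\<dots> \<in> X" by (rule subspace_scale[OF assms(2) diffX])
    finally show "Q (r *\<^sub>R f) = r *\<^sub>R Q f"
      by (rule uniq[OF subspace_scale[OF assms(3) PQ(2)]])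
  qed
  have "isCont Q 0" using Q by (simp add: continuous_on_eq_continuous_at)
  then obtain d where d: "d > 0" "\<And>f. norm f < d \<Longrightarrow> norm (Q f) < 1"
    using linear_0[OF lin] unfolding continuous_at_eps_delta
    by (metis dist_0_norm dist_commute zero_less_one)
  have "bounded_linear Q"
  proof (rule bounded_linear_intro[where K = "2 / d"])
    fix f
    show "norm (Q f) \<le> norm f * (2 / d)"
    proof (cases "f = 0")
      case True
      then show ?thesis by (simp add: linear_0[OF lin])
    next
      case False
      \<comment> \<open>Rescales \<open>f\<close> to norm \<open>d / 2\<close>, inside the ball
        where \<open>Q\<close> stays below 1; this is the origin of the constant
        \<open>2 / d\<close>.\<close>
      let ?r = "d / (2 * norm f)"
      have "norm (?r *\<^sub>R f) < d" using False d by simp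
      then have "norm (?r *\<^sub>R Q f) < 1"
        using d(2)[of "?r *\<^sub>R f"] by (simp add: linear_scale[OF lin])
      then show ?thesis using False d by (simp add: field_simps)
    qed
  qed (simp_all add: linear_add[OF lin] linear_scale[OF lin])
  moreover have "Q f = 0 \<longleftrightarrow> f \<in> X" for f
    using uniq[of 0 f] diffX[of f] subspace_0[OF assms(3)] by auto
  ultimately show ?thesis by blast
qed

lemma bounded_linear_linf_distr:
  assumes "integrable lborel \<phi>"
  shows "bounded_linear (\<lambda>f. linf_distr f \<phi>)"
  by (rule bounded_linear_intro[where K = "LINT x|lborel. cmod (\<phi> x)"])
    (simp_all add: linf_distr_add linf_distr_scaleR scaleR_conv_of_real linf_distr_bound assms)

theorem theorem21:
  fixes chi :: "'a::euclidean_space \<Rightarrow> real"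
  assumes "low_freq_cutoff chi"
  shows "\<nexists>G. linf.subspace G \<and> topological_direct_sum (Sh_linf chi) G"
proof
  assume "\<exists>G. linf.subspace G \<and> topological_direct_sum (Sh_linf chi) G"
  then obtain G where G: "linf.subspace G" "topological_direct_sum (Sh_linf chi) G" by blast
  obtain Q :: "'a linf \<Rightarrow> 'a linf"
    where Q: "bounded_linear Q" "\<And>f. Q f = 0 \<longleftrightarrow> f \<in> Sh_linf chi"
    using topological_direct_sum_projection[OF G(2) Sh_linf_subspace[OF assms] subspace_linf[OF G(1)]]
    by blast
  obtain E :: "'a set set" where E: "countable E" "Int_stable E" "UNIV \<in> E" "sets borel = sigma_sets UNIV E"
    by (rule countable_borel_generator)
  \<comment> \<open>A positive integrable weight, so that the indicator of every set in
    \<open>E\<close>, even of the whole space, gives an integrable test function.\<close>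
  define w where "w = (\<lambda>x::'a. inverse ((1 + norm x) ^ (DIM('a) + 2)))"
  have w: "integrable lborel w" "w x > 0" for x
    unfolding w_def using integrable_inverse_power by (auto simp: add_pos_nonneg)
  let ?\<phi> = "\<lambda>U x. complex_of_real (indicator U x * w x)"
  let ?F = "\<lambda>s. abs_linf (shells chi (branch s))"
  \<comment> \<open>The countability lemma concerns real functionals; \<open>\<rho>\<close> will be
    the real or the imaginary part.\<close>
  define Z where "Z \<rho> U = {s. \<rho> (linf_distr (Q (?F s)) (?\<phi> U)) \<noteq> 0}" for \<rho> :: "complex \<Rightarrow> real" and U
  have "countable (Z \<rho> U)" if "U \<in> E" "bounded_linear \<rho>" for \<rho> U
    unfolding Z_def
  proof (rule countable_nonvanishing)
    have "U \<in> sets borel" using that(1) E(4) by auto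
    then have "integrable lborel (?\<phi> U)"
      using integrable_mult_indicator[OF _ w(1), of U] by (intro integrable_of_real) simp
    then show "bounded_linear (\<lambda>f. \<rho> (linf_distr (Q f) (?\<phi> U)))"
      by (intro bounded_linear_compose[OF that(2)] bounded_linear_compose[OF bounded_linear_linf_distr] Q(1))
    fix f :: "'a \<Rightarrow> complex" and R
    assume "ess_bounded f" "\<And>x. norm x > R \<Longrightarrow> f x = 0"
    then have "Q (abs_linf f) = 0"
      unfolding Q(2) by (rule bounded_support_in_Sh_linf[OF assms])
    then show "\<rho> (linf_distr (Q (abs_linf f)) (?\<phi> U)) = 0"
      using linf_distr_scaleR[of 0 "0::'a linf" "?\<phi> U"]
      by (simp add: linear_0 bounded_linear.linear[OF that(2)])
  qed (use phase_measurable[OF assms] cmod_phase_le[OF assms] shell_index_bounded in auto)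
  then have "countable (\<Union>U\<in>E. Z Re U \<union> Z Im U)"
    using E(1) bounded_linear_Re bounded_linear_Im by (intro countable_UN) auto
  \<comment> \<open>Countably many functionals, each nonzero for countably many sequences only,
    leave a sequence on which all of them vanish.\<close>
  then obtain s where s: "s \<notin> (\<Union>U\<in>E. Z Re U \<union> Z Im U)"
    using uncountable_branches by (metis UNIV_eq_I)
  have "Q (?F s) = 0"
  proof (rule linf_eq_0I[OF w E(2,3,4)])
    fix U assume "U \<in> E"
    with s show "linf_distr (Q (?F s)) (?\<phi> U) = 0"
      by (auto simp: Z_def complex_eq_iff)
  qed
  then have "finite (branch s)"
    unfolding Q(2) by (rule shells_in_Sh_linf_finite[OF assms])
  with infinite_branch show False by blast
qed

end
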